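(* Let $\bar\epsilon\in\mathrm{int}(\mathcal{E})$ and let $(x^*(\bar\epsilon);y^*(\bar\epsilon);s^*(\bar\epsilon))$ be a strictly complementary optimal solution at $\bar\epsilon$. Then, for all sufficiently small $\delta>0$, the set $[\alpha(\delta),\beta(\delta)]\cap S_{\pi(\bar\epsilon)}$ is either a singleton or a subinterval of $S_{\pi(\bar\epsilon)}$ containing $\bar\epsilon$.
   Context: Setting. Let $\mathbb{L}^{n_i}_+=\{x^i\in\mathbb{R}^{n_i}: x^i_1\ge\|x^i_{2:n_i}\|\}$ ($\|\cdot\|$ the $\ell_2$ norm), with interior $\mathrm{int}(\mathbb{L}^{n_i}_+)=\{x^i: x^i_1>\|x^i_{2:n_i}\|\}$ and boundary $\mathrm{bd}(\mathbb{L}^{n_i}_+)=\{x^i: x^i_1=\|x^i_{2:n_i}\|\}$. Let $\mathcal{L}^{\bar n}_+=\mathbb{L}^{n_1}_+\times\cdots\times\mathbb{L}^{n_p}_+$, $\bar n=\sum_{i=1}^p n_i$. Data: $A=(A^1,\ldots,A^p)\in\mathbb{R}^{m\times\bar n}$ with $A^i\in\mathbb{R}^{m\times n_i}$, $b\in\mathbb{R}^m$, $c,\bar c\in\mathbb{R}^{\bar n}$, $\bar c\ne0$ fixed. For $\epsilon\in\mathbb{R}$ consider $(\mathrm{P}_\epsilon)$: $\inf_x\{(c+\epsilon\bar c)^Tx: Ax=b,\ x\in\mathcal{L}^{\bar n}_+\}$ and $(\mathrm{D}_\epsilon)$: $\sup_{(y;s)}\{b^Ty: A^Ty+s=c+\epsilon\bar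 c,\ s\in\mathcal{L}^{\bar n}_+\}$, with vectors partitioned as $x=(x^1;\ldots;x^p)$, $s=(s^1;\ldots;s^p)$. Standing assumptions: $A$ has full row rank, and at $\epsilon=0$ there is a feasible $(x;y;s)$ of $(\mathrm{P}_0)$ and $(\mathrm{D}_0)$ with $x^i,s^i\in\mathrm{int}(\mathbb{L}^{n_i}_+)$ for all $i$. $\psi(\epsilon)\in\mathbb{R}\cup\{\pm\infty\}$ is the optimal value of $(\mathrm{P}_\epsilon)$; $\mathcal{E}=\{\epsilon:\psi(\epsilon)\in\mathbb{R}\}$, which is a non-singleton closed interval. The optimal sets are $\mathcal{P}^*(\epsilon)=\{x\in\mathcal{L}^{\bar n}_+: Ax=b,\ (c+\epsilon\bar c)^Tx=\psi(\epsilon)\}$ and $\mathcal{D}^*(\epsilon)=\{(y;s): s\in\mathcal{L}^{\bar n}_+,\ A^Ty+s=c+\epsilon\bar c,\ b^Ty=\psi(\epsilon)\}$; they are nonempty and compact for $\epsilon\in\mathrm{int}(\mathcal{E})$. Optimal partition. $\mathcal{B}(\epsilon)=\{i:\exists x\in\mathcal{P}^*(\epsilon),\ x^i\in\mathrm{int}(\mathbb{L}^{n_i}_+)\}$; $\mathcal{N}(\epsilon)=\{i:\exists (y;s)\in\mathcal{D}^*(\epsilon),\ s^i\in\mathrm{int}(\mathbb{L}^{n_i}_+)\}$; $\mathcal{R}(\epsilon)=\{i:\exists (x;y;s)\in\mathcal{P}^*(\epsilon)\times\mathcal{D}^*(\epsilon),\ x^i,s^i\in\mathrm{bd}(\mathbb{L}^{n_i}_+)\setminus\{0\}\}$;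 $\mathcal{T}(\epsilon)=\{1,\ldots,p\}\setminus(\mathcal{B}(\epsilon)\cup\mathcal{N}(\epsilon)\cup\mathcal{R}(\epsilon))$. $\mathcal{T}(\epsilon)$ is further partitioned into $\mathcal{T}_1(\epsilon)=\{i\in\mathcal{T}(\epsilon): x^i=s^i=0\ \forall (x;y;s)\in\mathcal{P}^*(\epsilon)\times\mathcal{D}^*(\epsilon)\}$; $\mathcal{T}_2(\epsilon)=\{i\in\mathcal{T}(\epsilon):\exists x\in\mathcal{P}^*(\epsilon),\ x^i\in\mathrm{bd}(\mathbb{L}^{n_i}_+)\setminus\{0\}$, and $s^i=0\ \forall (y;s)\in\mathcal{D}^*(\epsilon)\}$; $\mathcal{T}_3(\epsilon)=\{i\in\mathcal{T}(\epsilon):\exists (y;s)\in\mathcal{D}^*(\epsilon),\ s^i\in\mathrm{bd}(\mathbb{L}^{n_i}_+)\setminus\{0\}$, and $x^i=0\ \forall x\in\mathcal{P}^*(\epsilon)\}$. The optimal partition is $\pi(\epsilon)=\{\mathcal{B}(\epsilon),\mathcal{N}(\epsilon),\mathcal{R}(\epsilon),\mathcal{T}(\epsilon)\}$ with $\mathcal{T}(\epsilon)=\{\mathcal{T}_1(\epsilon),\mathcal{T}_2(\epsilon),\mathcal{T}_3(\epsilon)\}$; equality of optimal partitions means equality of all these index sets. $S_{\pi(\bar\epsilon)}\subseteq\mathbb{R}$ is the set of all $\epsilon$ (with $\mathcal{P}^*(\epsilon)\times\mathcal{D}^*(\epsilon)\neq\emptyset$) whose optimal partition equals $\pi(\bar\epsilon)$.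 A strictly complementary optimal solution at $\epsilon$ is an element $(x^*(\epsilon);y^*(\epsilon);s^*(\epsilon))\in\mathcal{P}^*(\epsilon)\times\mathcal{D}^*(\epsilon)$ with $x^*(\epsilon)+s^*(\epsilon)\in\mathrm{int}(\mathcal{L}^{\bar n}_+)$. Product: $x\circ s=(x^1\circ s^1;\ldots;x^p\circ s^p)$ with $x^i\circ s^i=\big((x^i)^Ts^i;\ x^i_1s^i_{2:n_i}+s^i_1x^i_{2:n_i}\big)$. For the given strictly complementary optimal solution at $\bar\epsilon$ and $\delta\ge0$, let $\mathcal{S}(\delta,\bar\epsilon)=\{\epsilon\in\mathbb{R}:\exists (x;y;s)$ with $Ax=b$, $A^Ty+s=c+\epsilon\bar c$, $x\circ s=0$, $\|(x-x^*(\bar\epsilon);\,y-y^*(\bar\epsilon);\,s-s^*(\bar\epsilon))\|^2\le\delta^2\}$ (no cone constraints are imposed). This set is nonempty and compact, and $\alpha(\delta)=\min\mathcal{S}(\delta,\bar\epsilon)$, $\beta(\delta)=\max\mathcal{S}(\delta,\bar\epsilon)$. *)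

theory Defs
  imports "HOL-Analysis.Analysis"
begin

text \<open>
  The coordinates of the product space are indexed by a single finite type \<open>'n\<close>, the cones by a
  finite type \<open>'p\<close>. Coordinate \<open>j\<close> belongs to block \<open>blk P j\<close>, so that the dimension of block \<open>i\<close>
  is the cardinality of its \<open>blk P\<close>-preimage, and \<open>lead P i\<close> is the first coordinate of block \<open>i\<close>.
  The predicate \<open>block_structure\<close> makes every block nonempty and puts its leading coordinate in it.
\<close>

record ('m::finite, 'n::finite, 'p) psoco =
  blk :: "'n \<Rightarrow> 'p"
  lead :: "'p \<Rightarrow> 'n"
  Amat :: "real^'n^'m"
  rhs :: "real^'m"
  cost :: "real^'n"
  dcost :: "real^'n"

definition block_structure :: "('m::finite, 'n::finite, 'p) psoco \<Rightarrow> bool" where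
  "block_structure P \<longleftrightarrow> (\<forall>i. blk P (lead P i) = i)"

definition block :: "('m::finite, 'n::finite, 'p) psoco \<Rightarrow> 'p \<Rightarrow> 'n set" where
  "block P i = {j. blk P j = i}"

definition tail_norm :: "('m::finite, 'n::finite, 'p) psoco \<Rightarrow> 'p \<Rightarrow> real^'n \<Rightarrow> real" where
  "tail_norm P i x = L2_set (\<lambda>j. x $ j) (block P i - {lead P i})"

text \<open>The following predicates on \<open>x\<close> depend only on its subvector in block \<open>i\<close>.\<close>

definition blk_zero :: "('m::finite, 'n::finite, 'p) psoco \<Rightarrow> 'p \<Rightarrow> real^'n \<Rightarrow> bool" where
  "blk_zero P i x \<longleftrightarrow> (\<forall>j\<in>block P i. x $ j = 0)"

definition blk_cone :: "('m::finite, 'n::finite, 'p) psoco \<Rightarrow> 'p \<Rightarrow> real^'n \<Rightarrow> bool" where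
  "blk_cone P i x \<longleftrightarrow> x $ lead P i \<ge> tail_norm P i x"

definition blk_int :: "('m::finite, 'n::finite, 'p) psoco \<Rightarrow> 'p \<Rightarrow> real^'n \<Rightarrow> bool" where
  "blk_int P i x \<longleftrightarrow> x $ lead P i > tail_norm P i x"

definition blk_bd :: "('m::finite, 'n::finite, 'p) psoco \<Rightarrow> 'p \<Rightarrow> real^'n \<Rightarrow> bool" where
  "blk_bd P i x \<longleftrightarrow> x $ lead P i = tail_norm P i x"

definition soc :: "('m::finite, 'n::finite, 'p) psoco \<Rightarrow> (real^'n) set" where
  "soc P = {x. \<forall>i. blk_cone P i x}"

definition obj :: "('m::finite, 'n::finite, 'p) psoco \<Rightarrow> real \<Rightarrow> real^'n" where
  "obj P \<epsilon> = cost P + \<epsilon> *\<^sub>R dcost P"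

definition primal_feas :: "('m::finite, 'n::finite, 'p) psoco \<Rightarrow> (real^'n) set" where
  "primal_feas P = {x. Amat P *v x = rhs P \<and> x \<in> soc P}"

definition dual_feas :: "('m::finite, 'n::finite, 'p) psoco \<Rightarrow> real \<Rightarrow> ((real^'m) \<times> (real^'n)) set" where
  "dual_feas P \<epsilon> = {(y, s). transpose (Amat P) *v y + s = obj P \<epsilon> \<and> s \<in> soc P}"

definition interior_point_condition :: "('m::finite, 'n::finite, 'p) psoco \<Rightarrow> bool" where
  "interior_point_condition P \<longleftrightarrow>
     (\<exists>x\<in>primal_feas P. \<exists>(y, s)\<in>dual_feas P 0. \<forall>i. blk_int P i x \<and> blk_int P i s)"

definition opt_val :: "('m::finite, 'n::finite, 'p) psoco \<Rightarrow> real \<Rightarrow> ereal" where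
  "opt_val P \<epsilon> = (INF x\<in>primal_feas P. ereal (obj P \<epsilon> \<bullet> x))"

definition val_dom :: "('m::finite, 'n::finite, 'p) psoco \<Rightarrow> real set" where
  "val_dom P = {\<epsilon>. \<bar>opt_val P \<epsilon>\<bar> \<noteq> \<infinity>}"

definition primal_opt :: "('m::finite, 'n::finite, 'p) psoco \<Rightarrow> real \<Rightarrow> (real^'n) set" where
  "primal_opt P \<epsilon> = {x \<in> primal_feas P. ereal (obj P \<epsilon> \<bullet> x) = opt_val P \<epsilon>}"

text \<open>Dual optimality is measured against the primal optimal value, so the set is empty whenever
  there is a duality gap.\<close>

definition dual_opt :: "('m::finite, 'n::finite, 'p) psoco \<Rightarrow> real \<Rightarrow> ((real^'m) \<times> (real^'n)) set" where
  "dual_opt P \<epsilon> = {(y, s) \<in> dual_feas P \<epsilon>. ereal (rhs P \<bullet> y) = opt_val P \<epsilon>}"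

definition part_B :: "('m::finite, 'n::finite, 'p) psoco \<Rightarrow> real \<Rightarrow> 'p set" where
  "part_B P \<epsilon> = {i. \<exists>x\<in>primal_opt P \<epsilon>. blk_int P i x}"

definition part_N :: "('m::finite, 'n::finite, 'p) psoco \<Rightarrow> real \<Rightarrow> 'p set" where
  "part_N P \<epsilon> = {i. \<exists>(y, s)\<in>dual_opt P \<epsilon>. blk_int P i s}"

definition part_R :: "('m::finite, 'n::finite, 'p) psoco \<Rightarrow> real \<Rightarrow> 'p set" where
  "part_R P \<epsilon> = {i. \<exists>x\<in>primal_opt P \<epsilon>. \<exists>(y, s)\<in>dual_opt P \<epsilon>.
     blk_bd P i x \<and> \<not> blk_zero P i x \<and> blk_bd P i s \<and> \<not> blk_zero P i s}"

definition part_T :: "('m::finite, 'n::finite, 'p) psoco \<Rightarrow> real \<Rightarrow> 'p set" where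
  "part_T P \<epsilon> = UNIV - (part_B P \<epsilon> \<union> part_N P \<epsilon> \<union> part_R P \<epsilon>)"

definition part_T1 :: "('m::finite, 'n::finite, 'p) psoco \<Rightarrow> real \<Rightarrow> 'p set" where
  "part_T1 P \<epsilon> = {i \<in> part_T P \<epsilon>. \<forall>x\<in>primal_opt P \<epsilon>. \<forall>(y, s)\<in>dual_opt P \<epsilon>.
     blk_zero P i x \<and> blk_zero P i s}"

definition part_T2 :: "('m::finite, 'n::finite, 'p) psoco \<Rightarrow> real \<Rightarrow> 'p set" where
  "part_T2 P \<epsilon> = {i \<in> part_T P \<epsilon>.
     (\<exists>x\<in>primal_opt P \<epsilon>. blk_bd P i x \<and> \<not> blk_zero P i x) \<and>
     (\<forall>(y, s)\<in>dual_opt P \<epsilon>. blk_zero P i s)}"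

definition part_T3 :: "('m::finite, 'n::finite, 'p) psoco \<Rightarrow> real \<Rightarrow> 'p set" where
  "part_T3 P \<epsilon> = {i \<in> part_T P \<epsilon>.
     (\<exists>(y, s)\<in>dual_opt P \<epsilon>. blk_bd P i s \<and> \<not> blk_zero P i s) \<and>
     (\<forall>x\<in>primal_opt P \<epsilon>. blk_zero P i x)}"

definition opt_partition ::
  "('m::finite, 'n::finite, 'p) psoco \<Rightarrow> real \<Rightarrow>
     'p set \<times> 'p set \<times> 'p set \<times> 'p set \<times> 'p set \<times> 'p set \<times> 'p set" where
  "opt_partition P \<epsilon> =
     (part_B P \<epsilon>, part_N P \<epsilon>, part_R P \<epsilon>, part_T P \<epsilon>, part_T1 P \<epsilon>, part_T2 P \<epsilon>, part_T3 P \<epsilon>)"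

definition same_partition_set :: "('m::finite, 'n::finite, 'p) psoco \<Rightarrow> real \<Rightarrow> real set" where
  "same_partition_set P \<epsilon>0 =
     {\<epsilon>. primal_opt P \<epsilon> \<times> dual_opt P \<epsilon> \<noteq> {} \<and> opt_partition P \<epsilon> = opt_partition P \<epsilon>0}"

definition strictly_complementary ::
  "('m::finite, 'n::finite, 'p) psoco \<Rightarrow> real \<Rightarrow> real^'n \<Rightarrow> real^'m \<Rightarrow> real^'n \<Rightarrow> bool" where
  "strictly_complementary P \<epsilon> x y s \<longleftrightarrow>
     x \<in> primal_opt P \<epsilon> \<and> (y, s) \<in> dual_opt P \<epsilon> \<and> x + s \<in> interior (soc P)"

definition jordan_prod ::
  "('m::finite, 'n::finite, 'p) psoco \<Rightarrow> real^'n \<Rightarrow> real^'n \<Rightarrow> real^'n" where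
  "jordan_prod P x s = (\<chi> j. let i = blk P j in
     if j = lead P i then \<Sum>k\<in>block P i. x $ k * s $ k
     else x $ lead P i * s $ j + s $ lead P i * x $ j)"

text \<open>The norm on a product type is the Euclidean norm of the concatenated vector.\<close>

definition pert_set ::
  "('m::finite, 'n::finite, 'p) psoco \<Rightarrow> real^'n \<Rightarrow> real^'m \<Rightarrow> real^'n \<Rightarrow> real \<Rightarrow> real set" where
  "pert_set P x0 y0 s0 \<delta> = {\<epsilon>. \<exists>x y s.
     Amat P *v x = rhs P \<and> transpose (Amat P) *v y + s = obj P \<epsilon> \<and> jordan_prod P x s = 0 \<and>
     (norm (x - x0, y - y0, s - s0))\<^sup>2 \<le> \<delta>\<^sup>2}"

definition pert_min ::
  "('m::finite, 'n::finite, 'p) psoco \<Rightarrow> real^'n \<Rightarrow> real^'m \<Rightarrow> real^'n \<Rightarrow> real \<Rightarrow> real" where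
  "pert_min P x0 y0 s0 \<delta> = (LEAST \<epsilon>. \<epsilon> \<in> pert_set P x0 y0 s0 \<delta>)"

definition pert_max ::
  "('m::finite, 'n::finite, 'p) psoco \<Rightarrow> real^'n \<Rightarrow> real^'m \<Rightarrow> real^'n \<Rightarrow> real \<Rightarrow> real" where
  "pert_max P x0 y0 s0 \<delta> = (GREATEST \<epsilon>. \<epsilon> \<in> pert_set P x0 y0 s0 \<delta>)"

text \<open>The topological interior of the product cone is the product of the blockwise interiors.\<close>

lemma continuous_on_tail_norm: "continuous_on UNIV (tail_norm P i)"
  unfolding tail_norm_def [abs_def] L2_set_def by (intro continuous_intros)

lemma interior_soc:
  fixes P :: "('m::finite, 'n::finite, 'p::finite) psoco"
  assumes "block_structure P"
  shows "interior (soc P) = {x. \<forall>i. blk_int P i x}"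
proof (rule interior_unique)
  show "{x. \<forall>i. blk_int P i x} \<subseteq> soc P"
    by (auto simp: soc_def blk_cone_def blk_int_def intro: less_imp_le)
  have "open {x. tail_norm P i x < x $ lead P i}" for i
    by (intro open_Collect_less continuous_on_tail_norm continuous_intros)
  then show "open {x. \<forall>i. blk_int P i x}"
    unfolding blk_int_def Collect_all_eq by (intro open_INT) auto
next
  fix U assume U: "U \<subseteq> soc P" "open U"
  show "U \<subseteq> {x. \<forall>i. blk_int P i x}"
  proof (clarify)
    fix x i assume "x \<in> U"
    then obtain e where e: "e > 0" "cball x e \<subseteq> U"
      using U(2) open_contains_cball by blast
    define z where "z = x - e *\<^sub>R axis (lead P i) 1"
    have "dist x z = e" using e(1) by (simp add: z_def dist_norm)
    then have "z \<in> soc P" using e U by auto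
    then have "tail_norm P i z \<le> z $ lead P i" by (simp add: soc_def blk_cone_def)
    moreover have "tail_norm P i z = tail_norm P i x"
      unfolding tail_norm_def by (rule L2_set_cong) (auto simp: z_def axis_def)
    moreover have "z $ lead P i = x $ lead P i - e" by (simp add: z_def)
    ultimately show "blk_int P i x" using e(1) by (simp add: blk_int_def)
  qed
qed

end

theory Submission
  imports Defs
begin

text \<open>
  The set of parameters with the same optimal partition as \<open>\<epsilon>0\<close> is semialgebraic: it is defined by
  polynomial equations and inequalities between real vectors, combined with quantifiers over such vectors.
  By the Tarski--Seidenberg theorem the quantifiers can be eliminated, so this subset of the line is
  described by the signs of finitely many polynomials in one variable
  (\<open>semialgebraic_same_partition\<close>). Such a set cannot oscillate at a point. Immediately to the left of \<open>\<epsilon>0\<close>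
  it contains everything or nothing, and likewise to the right, and it contains \<open>\<epsilon>0\<close> itself. Hence its
  intersection with a short interval around \<open>\<epsilon>0\<close> is an interval (\<open>semialgebraic_interval_near\<close>).

  The other half of the argument says that \<open>[\<alpha>(\<delta>), \<beta>(\<delta>)]\<close> is such a short interval. The given optimal
  solution is complementary and so solves the system that defines the perturbation set, which puts \<open>\<epsilon>0\<close>
  into this set (\<open>optimal_complementary\<close>, \<open>jordan_prod_eq_0\<close>). The parameter is a continuous function of the solution of that system,
  so the perturbation set is compact, attains its extrema, and shrinks to \<open>\<epsilon>0\<close> as \<open>\<delta>\<close> tends to zero
  (\<open>pert_min_max\<close>, \<open>pert_set_near\<close>).

  Some finiteness principle of this kind is essential. For general convex constraints, convexity and
  continuity do not exclude that parameters with the given partition accumulate at \<open>\<epsilon>0\<close> between parameters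
  with other partitions: two constraint boundaries that meet in an optimal point can be graphs of convex
  functions whose difference has infinitely many zeros near \<open>\<epsilon>0\<close>. For second-order cones such functions are algebraic.

  Quantifier elimination is proved in the manner of Cohen and Hormander. Two parameters are compared
  through a sign diagram, a finite increasing correspondence between the roots of the univariate polynomials
  at one parameter and those at the other, such that the signs agree on corresponding cells. The signs of
  a polynomial are determined by those of its derivative and of its remainders modulo the other
  polynomials, which have lower degree (\<open>sign_extension\<close>, \<open>sign_diagram_insert\<close>). By induction, finitely
  many sign conditions on polynomials in the coefficients ensure that a diagram exists
  (\<open>sign_diagram_determined_by_coefficients\<close>).
\<close>

section \<open>Matched points of two real lines\<close>

text \<open>
  A finite set \<open>C\<close> of pairs \<open>(a, a')\<close> cuts one copy of the real line at the points \<open>a\<close> and another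
  copy at the points \<open>a'\<close>. Two numbers are matched when they lie in corresponding cells (cut points or
  gaps). Sets of pairs are used instead of order isomorphisms of the line because adding cut points then
  only refines the matching, and exchanging the two lines is taking the converse.
\<close>

definition matched :: "(real \<times> real) set \<Rightarrow> real \<Rightarrow> real \<Rightarrow> bool" where
  "matched C x x' \<longleftrightarrow> (\<forall>(a, a')\<in>C. sgn (x - a) = sgn (x' - a'))"

definition monotone_pairs :: "(real \<times> real) set \<Rightarrow> bool" where
  "monotone_pairs C \<longleftrightarrow> finite C \<and> (\<forall>(a, a')\<in>C. matched C a a')"

definition signs_agree :: "(real \<times> real) set \<Rightarrow> real poly \<Rightarrow> real poly \<Rightarrow> bool" where
  "signs_agree C f g \<longleftrightarrow> (\<forall>x x'. matched C x x' \<longrightarrow> sgn (poly f x) = sgn (poly g x'))"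

lemma matched_converse: "matched (C\<inverse>) x' x \<longleftrightarrow> matched C x x'"
  unfolding matched_def converse_unfold by (auto simp: eq_commute)

lemma monotone_pairs_converse: "monotone_pairs (C\<inverse>) \<longleftrightarrow> monotone_pairs C"
  by (auto simp: monotone_pairs_def matched_converse)

lemma signs_agree_converse: "signs_agree (C\<inverse>) g f \<longleftrightarrow> signs_agree C f g"
  unfolding signs_agree_def matched_converse by metis

lemma matchedD: "matched C x x' \<Longrightarrow> (a, a') \<in> C \<Longrightarrow> sgn (x - a) = sgn (x' - a')"
  by (auto simp: matched_def)

lemma matched_subset: "matched D x x' \<Longrightarrow> C \<subseteq> D \<Longrightarrow> matched C x x'"
  by (auto simp: matched_def)

lemma monotone_pairs_subset: "monotone_pairs D \<Longrightarrow> C \<subseteq> D \<Longrightarrow> monotone_pairs C"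
  unfolding monotone_pairs_def matched_def by (blast dest: finite_subset)

lemma monotone_pairsD: "monotone_pairs C \<Longrightarrow> (a, a') \<in> C \<Longrightarrow> matched C a a'"
  by (auto simp: monotone_pairs_def)

lemma sgn_diff_eq_iff:
  fixes x a x' a' :: real
  shows "sgn (x - a) = sgn (x' - a') \<longleftrightarrow> (x < a \<longleftrightarrow> x' < a') \<and> (x = a \<longleftrightarrow> x' = a')"
  by (auto simp: sgn_if)

lemma matched_point:
  assumes "matched C x x'" "(a, a') \<in> C"
  shows "x = a \<longleftrightarrow> x' = a'"
  using matchedD[OF assms] by (simp add: sgn_diff_eq_iff)

lemma matched_not_point:
  assumes "matched C x x'" "x \<notin> fst ` C"
  shows "x' \<notin> snd ` C"
  using assms matched_point by force

lemma finite_sets_gap: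
  fixes L H :: "real set"
  assumes "finite L" "finite H" "\<And>l h. l \<in> L \<Longrightarrow> h \<in> H \<Longrightarrow> l < h"
  shows "\<exists>m. (\<forall>l\<in>L. l < m) \<and> (\<forall>h\<in>H. m < h)"
proof -
  consider "L = {}" "H = {}" | "L = {}" "H \<noteq> {}" | "L \<noteq> {}" "H = {}" | "L \<noteq> {}" "H \<noteq> {}" by blast
  then show ?thesis
  proof cases
    case 1
    then show ?thesis by simp
  next
    case 2
    obtain m where "m < Min H" using lt_ex by blast
    with 2 assms(2) show ?thesis by auto
  next
    case 3
    obtain m where "Max L < m" using gt_ex by blast
    with 3 assms(1) show ?thesis by auto
  next
    case 4
    then have "Max L < Min H" using assms by auto
    then obtain m where "Max L < m" "m < Min H" using dense by blast
    then have "(\<forall>l\<in>L. l < m) \<and> (\<forall>h\<in>H. m < h)" using 4 assms by auto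
    then show ?thesis ..
  qed
qed

text \<open>
  Since \<open>C\<close> is increasing, the partners of the cut points left of \<open>x\<close> lie left of the partners of
  those right of \<open>x\<close>, so there is room for \<open>x'\<close> between them.
\<close>

lemma matched_exists:
  assumes "monotone_pairs C"
  shows "\<exists>x'. matched C x x'"
proof (cases "x \<in> fst ` C")
  case True
  then obtain a' where "(x, a') \<in> C" by force
  with assms show ?thesis by (auto dest: monotone_pairsD)
next
  case False
  define L where "L = {a'. \<exists>a. (a, a') \<in> C \<and> a < x}"
  define H where "H = {a'. \<exists>a. (a, a') \<in> C \<and> x < a}"
  have C: "finite C" using assms by (simp add: monotone_pairs_def)
  have "L \<subseteq> snd ` C" "H \<subseteq> snd ` C" by (force simp: L_def H_def)+
  then have fin: "finite L" "finite H" using C by (auto intro: finite_subset)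
  have "l < h" if "l \<in> L" "h \<in> H" for l h
  proof -
    from that obtain a b where ab: "(a, l) \<in> C" "a < x" "(b, h) \<in> C" "x < b"
      by (auto simp: L_def H_def)
    then have "sgn (a - b) = sgn (l - h)" by (intro matchedD[OF monotone_pairsD[OF assms]])
    with ab show ?thesis unfolding sgn_diff_eq_iff by linarith
  qed
  then obtain m where m: "\<forall>l\<in>L. l < m" "\<forall>h\<in>H. m < h"
    using finite_sets_gap[OF fin] by blast
  have "matched C x m"
    unfolding matched_def sgn_diff_eq_iff
  proof clarify
    fix a a' assume a: "(a, a') \<in> C"
    with False have "a \<noteq> x" by force
    then consider "a < x" | "x < a" by linarith
    then show "(x < a \<longleftrightarrow> m < a') \<and> (x = a \<longleftrightarrow> m = a')"
    proof cases
      case 1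
      then have "a' < m" using a m by (auto simp: L_def)
      with 1 show ?thesis by auto
    next
      case 2
      then have "m < a'" using a m by (auto simp: H_def)
      with 2 show ?thesis by auto
    qed
  qed
  then show ?thesis ..
qed

lemma matched_exists': "monotone_pairs C \<Longrightarrow> \<exists>x. matched C x x'"
  using matched_exists[of "C\<inverse>" x'] by (auto simp: matched_converse monotone_pairs_converse)

lemma matched_between:
  assumes "matched C x x'" "matched C y x'" "x \<le> z" "z \<le> y"
  shows "matched C z x'"
  unfolding matched_def sgn_diff_eq_iff
proof clarify
  fix a a' assume "(a, a') \<in> C"
  with assms matchedD[of C x x' a a'] matchedD[of C y x' a a']
  show "(z < a \<longleftrightarrow> x' < a') \<and> (z = a \<longleftrightarrow> x' = a')"
    by (auto simp: sgn_diff_eq_iff)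
qed

lemma matched_between':
  assumes "matched C x x'" "matched C x y'" "x' \<le> z" "z \<le> y'"
  shows "matched C x z"
  using matched_between[of "C\<inverse>" x' x y' z] assms by (simp add: matched_converse)

lemma eventually_matched:
  assumes "finite C" "matched C x x'" "x' \<notin> snd ` C"
  shows "\<forall>\<^sub>F y' in nhds x'. matched C x y'"
proof -
  have "\<forall>c\<in>C. \<forall>\<^sub>F y' in nhds x'. sgn (x - fst c) = sgn (y' - snd c)"
  proof clarify
    fix a a' assume a: "(a, a') \<in> C"
    then have ne: "x' \<noteq> a'" using assms(3) by force
    have sg: "(x < a \<longleftrightarrow> x' < a') \<and> (x = a \<longleftrightarrow> x' = a')"
      using matchedD[OF assms(2) a] unfolding sgn_diff_eq_iff .
    have "\<forall>\<^sub>F y' in nhds x'. (x < a \<longleftrightarrow> y' < a') \<and> (x = a \<longleftrightarrow> y' = a')"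
    proof (cases "x' < a'")
      case True
      have "\<forall>\<^sub>F y' in nhds x'. y' < a'"
        using eventually_nhds_in_open[of "{..<a'}" x'] True by simp
      then show ?thesis by eventually_elim (use sg ne True in auto)
    next
      case False
      have "\<forall>\<^sub>F y' in nhds x'. a' < y'"
        using eventually_nhds_in_open[of "{a'<..}" x'] False ne by simp
      then show ?thesis by eventually_elim (use sg ne False in auto)
    qed
    then show "\<forall>\<^sub>F y' in nhds x'. sgn (x - fst (a, a')) = sgn (y' - snd (a, a'))"
      unfolding sgn_diff_eq_iff by simp
  qed
  then have "\<forall>\<^sub>F y' in nhds x'. \<forall>c\<in>C. sgn (x - fst c) = sgn (y' - snd c)"
    using assms(1) by (intro eventually_ball_finite)
  then show ?thesis by (simp add: matched_def case_prod_unfold)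
qed

lemma matched_neighbourhood:
  assumes "finite C" "matched C x x'" "x' \<notin> snd ` C"
  shows "\<exists>e>0. \<forall>y'. \<bar>y' - x'\<bar> < e \<longrightarrow> matched C x y'"
  using eventually_matched[OF assms] unfolding eventually_nhds_metric dist_real_def .

lemma infinite_matched:
  assumes "finite C" "matched C x x'" "x' \<notin> snd ` C"
  shows "infinite {y'. matched C x y'}"
proof -
  obtain e where e: "e > 0" "\<forall>y'. \<bar>y' - x'\<bar> < e \<longrightarrow> matched C x y'"
    using matched_neighbourhood[OF assms] by blast
  then have "{x'<..<x' + e} \<subseteq> {y'. matched C x y'}" by auto
  with e(1) show ?thesis by (meson finite_subset infinite_Ioo less_add_same_cancel1)
qed

lemma signs_agree_root_iff:
  assumes "signs_agree C f g" "matched C x x'"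
  shows "poly f x = 0 \<longleftrightarrow> poly g x' = 0"
  using assms unfolding signs_agree_def by (metis sgn_0_0)

lemma signs_agree_zero_iff:
  assumes "monotone_pairs C" "signs_agree C f g"
  shows "f = 0 \<longleftrightarrow> g = 0"
proof -
  have *: "g = 0" if "monotone_pairs C" "signs_agree C f g" "f = 0" for C f g
  proof -
    have "poly g x' = 0" for x'
      using matched_exists'[OF that(1), of x'] signs_agree_root_iff[OF that(2)] that(3) by auto
    then show ?thesis using poly_all_0_iff_0 by blast
  qed
  from *[of C f g] *[of "C\<inverse>" g f] assms show ?thesis
    by (auto simp: monotone_pairs_converse signs_agree_converse)
qed

text \<open>
  Agreement of signs forces cut points where they are needed: a root of \<open>f\<close> in the interior of a gap
  would make \<open>g\<close> vanish on the whole corresponding gap, which is infinite.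
\<close>

lemma root_is_matched_point:
  assumes "monotone_pairs C" "signs_agree C f g" "f \<noteq> 0" "poly f t = 0"
  shows "t \<in> fst ` C"
proof (rule ccontr)
  assume t: "t \<notin> fst ` C"
  obtain t' where t': "matched C t t'" using matched_exists[OF assms(1)] by blast
  have "infinite {y'. matched C t y'}"
    using infinite_matched[OF _ t'] matched_not_point[OF t' t] assms(1) by (simp add: monotone_pairs_def)
  moreover have "{y'. matched C t y'} \<subseteq> {y'. poly g y' = 0}"
    using signs_agree_root_iff[OF assms(2)] assms(4) by auto
  ultimately have "g = 0" using poly_roots_finite finite_subset by blast
  with signs_agree_zero_iff[OF assms(1,2)] assms(3) show False by simp
qed

lemma root_is_matched_point':
  assumes "monotone_pairs C" "signs_agree C f g" "g \<noteq> 0" "poly g t = 0"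
  shows "t \<in> snd ` C"
  using root_is_matched_point[of "C\<inverse>" g f t] assms
  by (force simp: monotone_pairs_converse signs_agree_converse)

section \<open>Sign diagrams and their restriction\<close>

text \<open>
  The pairs in \<open>R\<close> are the values of polynomials at two parameters. Besides agreement of signs, every cut
  point is required to be a root of some polynomial of the family; the sign of a further polynomial at a
  cut point is found by reducing it modulo a polynomial that vanishes there.
\<close>

definition sign_diagram :: "(real \<times> real) set \<Rightarrow> (real poly \<times> real poly) set \<Rightarrow> bool" where
  "sign_diagram C R \<longleftrightarrow> monotone_pairs C \<and> (\<forall>(f, g)\<in>R. signs_agree C f g) \<and>
     (\<forall>(a, a')\<in>C. \<exists>(f, g)\<in>R. f \<noteq> 0 \<and> poly f a = 0)"

lemma sign_change_root:
  fixes g :: "real poly"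
  assumes "sgn (poly g x) \<noteq> sgn (poly g y)"
  shows "\<exists>z. (x \<le> z \<and> z \<le> y \<or> y \<le> z \<and> z \<le> x) \<and> poly g z = 0"
proof -
  have *: "\<exists>z. x \<le> z \<and> z \<le> y \<and> poly g z = 0"
    if "x \<le> y" "sgn (poly g x) \<noteq> sgn (poly g y)" for x y
  proof (cases "poly g x = 0 \<or> poly g y = 0")
    case True
    then show ?thesis using that(1) by auto
  next
    case False
    then have "poly g x < 0 \<and> 0 < poly g y \<or> 0 < poly g x \<and> poly g y < 0"
      using that(2) by (auto simp: sgn_if split: if_splits)
    moreover from this have "x < y" using that(1) by (cases "x = y") auto
    ultimately show ?thesis
      using poly_IVT_pos[of x y g] poly_IVT_neg[of x y g] by (meson less_imp_le)
  qed
  show ?thesis using *[of x y] *[of y x] assms linorder_le_cases[of x y] by metis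
qed

text \<open>
  When polynomials are dropped, only the roots of the remaining ones are kept as cut points. The cells
  become larger, but by the intermediate value theorem no remaining polynomial changes its sign in a
  merged cell, as its roots are still cut points.
\<close>

lemma sign_diagram_restrict:
  assumes "sign_diagram C R" "R0 \<subseteq> R"
  shows "\<exists>C0\<subseteq>C. sign_diagram C0 R0"
proof -
  define C0 where "C0 = {(a, a')\<in>C. \<exists>(f, g)\<in>R0. f \<noteq> 0 \<and> poly f a = 0}"
  have sub: "C0 \<subseteq> C" by (auto simp: C0_def)
  have C: "monotone_pairs C" "\<And>f g. (f, g) \<in> R0 \<Longrightarrow> signs_agree C f g"
    using assms by (auto simp: sign_diagram_def)
  have C0: "monotone_pairs C0" using monotone_pairs_subset C(1) sub .
  have "signs_agree C0 f g" if fg: "(f, g) \<in> R0" for f g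
    unfolding signs_agree_def
  proof (intro allI impI)
    fix y y' assume y: "matched C0 y y'"
    obtain x' where x': "matched C y x'" using matched_exists[OF C(1)] by blast
    have x'0: "matched C0 y x'" using matched_subset x' sub .
    have "sgn (poly f y) = sgn (poly g x')" using C(2)[OF fg] x' by (simp add: signs_agree_def)
    also have "\<dots> = sgn (poly g y')"
    proof (rule ccontr)
      assume ne: "sgn (poly g x') \<noteq> sgn (poly g y')"
      then have "g \<noteq> 0" by auto
      obtain z where z: "x' \<le> z \<and> z \<le> y' \<or> y' \<le> z \<and> z \<le> x'" "poly g z = 0"
        using sign_change_root[OF ne] by blast
      then have "z \<in> snd ` C"
        using root_is_matched_point'[OF C(1) C(2)[OF fg] \<open>g \<noteq> 0\<close>] by blast
      then obtain w where w: "(w, z) \<in> C" by auto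
      have "poly f w = 0" using signs_agree_root_iff[OF C(2)[OF fg] monotone_pairsD[OF C(1) w]] z(2) by simp
      moreover have "f \<noteq> 0" using signs_agree_zero_iff[OF C(1) C(2)[OF fg]] \<open>g \<noteq> 0\<close> by simp
      ultimately have "(w, z) \<in> C0" using w fg by (auto simp: C0_def)
      from matchedD[OF y this] matchedD[OF x'0 this] have "x' = y'"
        using z(1) unfolding sgn_diff_eq_iff by linarith
      with ne show False by simp
    qed
    finally show "sgn (poly f y) = sgn (poly g y')" .
  qed
  then have "sign_diagram C0 R0"
    using C0 by (auto simp: sign_diagram_def C0_def)
  with sub show ?thesis by blast
qed

text \<open>
  A function that increases on a gap is negative somewhere in it if and only if it is negative near
  the left end. If the gap starts at a cut point, its sign there is the same on both lines; if the
  gap extends to \<open>-\<infinity>\<close>, an increasing function that is unbounded there is negative in any case.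
\<close>

lemma negative_value_transfers:
  fixes f g f' g' :: "real \<Rightarrow> real"
  assumes C: "monotone_pairs C" and x: "matched C x x'" "x \<notin> fst ` C"
    and f: "\<And>t. (f has_real_derivative f' t) (at t)" "\<And>y. matched C y x' \<Longrightarrow> f' y > 0"
    and g: "\<And>t. (g has_real_derivative g' t) (at t)" "\<And>y'. matched C x y' \<Longrightarrow> g' y' > 0"
    and unbounded: "\<And>t. \<exists>s\<le>t. \<bar>g t\<bar> < \<bar>g s\<bar>"
    and ends: "\<And>a a'. (a, a') \<in> C \<Longrightarrow> f a < 0 \<Longrightarrow> g a' < 0"
    and y: "matched C y x'" "f y < 0"
  shows "\<exists>y'. matched C x y' \<and> g y' < 0"
proof (cases "\<exists>(a, a')\<in>C. a < x")
  case False
  have left: "matched C x t" if "t \<le> x'" for t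
    unfolding matched_def sgn_diff_eq_iff
  proof clarify
    fix a a' assume a: "(a, a') \<in> C"
    with False x(2) have "x < a" by force
    then show "(x < a \<longleftrightarrow> t < a') \<and> (x = a \<longleftrightarrow> t = a')"
      using matchedD[OF x(1) a] that unfolding sgn_diff_eq_iff by auto
  qed
  obtain s where s: "s \<le> x'" "\<bar>g x'\<bar> < \<bar>g s\<bar>" using unbounded by blast
  have "g s < g x'"
  proof (rule DERIV_pos_imp_increasing[where f = g])
    show "s < x'" using s by (cases "s = x'") auto
    fix t assume "s \<le> t" "t \<le> x'"
    then show "\<exists>d. (g has_real_derivative d) (at t) \<and> d > 0" using g left by blast
  qed
  with s(2) have "g s < 0" by linarith
  with left[OF s(1)] show ?thesis by blast
next
  case True
  \<comment> \<open>The gap that contains \<open>x\<close> starts at the largest cut point \<open>a\<close> below it.\<close>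
  define L where "L = {a \<in> fst ` C. a < x}"
  have L: "finite L" "L \<noteq> {}" using C True by (force simp: L_def monotone_pairs_def)+
  define a where "a = Max L"
  have "a \<in> L" unfolding a_def using L by (rule Max_in)
  then obtain a' where a: "(a, a') \<in> C" "a < x" by (auto simp: L_def)
  have max: "b \<le> a" if "(b, b') \<in> C" "b < x" for b b'
    unfolding a_def using L that by (intro Max_ge) (force simp: L_def)+
  have "a' < x'" using matchedD[OF x(1) a(1)] a(2) unfolding sgn_diff_eq_iff by linarith
  have "a < y"
    using matchedD[OF y(1) a(1)] \<open>a' < x'\<close> unfolding sgn_diff_eq_iff by linarith
  have gap: "matched C t x'" if "a < t" "t \<le> y" for t
    unfolding matched_def sgn_diff_eq_iff
  proof clarify
    fix b b' assume b: "(b, b') \<in> C"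
    have "b \<noteq> x" using b x(2) by force
    then consider "b \<le> a" | "x < b" using max[OF b] by linarith
    then show "(t < b \<longleftrightarrow> x' < b') \<and> (t = b \<longleftrightarrow> x' = b')"
      using matchedD[OF x(1) b] matchedD[OF y(1) b] that a(2) unfolding sgn_diff_eq_iff
      by cases linarith+
  qed
  have gap': "matched C x t" if "a' < t" "t \<le> x'" for t
    unfolding matched_def sgn_diff_eq_iff
  proof clarify
    fix b b' assume b: "(b, b') \<in> C"
    have "b \<noteq> x" using b x(2) by force
    then consider "b \<le> a" | "x < b" using max[OF b] by linarith
    then show "(x < b \<longleftrightarrow> t < b') \<and> (x = b \<longleftrightarrow> t = b')"
      using matchedD[OF x(1) b] matchedD[OF monotone_pairsD[OF C a(1)] b] that a(2)
      unfolding sgn_diff_eq_iff by cases linarith+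
  qed
  obtain z where z: "a < z" "z < y" "f y - f a = (y - a) * f' z"
    using MVT2[OF \<open>a < y\<close>, of f f'] f(1) by blast
  have "0 < f' z" using f(2) gap z(1,2) by simp
  then have "0 < f y - f a" unfolding z(3) using \<open>a < y\<close> by simp
  then have "g a' < 0" using ends[OF a(1)] y(2) by linarith
  have "isCont g a'" using g(1) DERIV_isCont by blast
  then have "\<forall>\<^sub>F t in at_right a'. g t < 0"
    using \<open>g a' < 0\<close> order_tendstoD(2)[of g "g a'" "at a'" 0] filterlim_mono
    by (metis at_le eventually_at_split isCont_def)
  moreover have "\<forall>\<^sub>F t in at_right a'. a' < t \<and> t < x'"
    using eventually_at_right_real[OF \<open>a' < x'\<close>] by simp
  ultimately have "\<forall>\<^sub>F t in at_right a'. matched C x t \<and> g t < 0"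
    by eventually_elim (use gap' in auto)
  then show ?thesis
    using eventually_happens'[of "at_right a'"] by (auto simp: trivial_limit_at_right_real)
qed

section \<open>Monotone pieces of two polynomials\<close>

lemma poly_unbounded_along_ray:
  fixes g :: "real poly" and \<rho> :: real
  assumes "0 < degree g" "\<rho> = 1 \<or> \<rho> = -1"
  shows "\<exists>s\<le>t. \<bar>poly g (\<rho> * t)\<bar> < \<bar>poly g (\<rho> * s)\<bar>"
proof -
  have "filterlim (poly g) at_infinity at_infinity"
    using assms(1) by (rule filterlim_poly_at_infinity)
  moreover have "filterlim (\<lambda>s. \<rho> * s) at_infinity at_bot"
    using assms(2)
  proof
    assume "\<rho> = 1"
    then show ?thesis
      using filterlim_mono[OF filterlim_ident at_bot_le_at_infinity order_refl] by simp
  next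
    assume "\<rho> = -1"
    then show ?thesis
      using filterlim_at_top_imp_at_infinity[OF filterlim_uminus_at_top_at_bot] by simp
  qed
  ultimately have "filterlim (\<lambda>s. poly g (\<rho> * s)) at_infinity at_bot"
    by (rule filterlim_compose)
  then have "\<forall>\<^sub>F s in at_bot. \<bar>poly g (\<rho> * t)\<bar> < \<bar>poly g (\<rho> * s)\<bar>"
    by (simp add: filterlim_at_infinity_conv_norm_at_top filterlim_at_top_dense)
  then have "\<forall>\<^sub>F s in at_bot. s \<le> t \<and> \<bar>poly g (\<rho> * t)\<bar> < \<bar>poly g (\<rho> * s)\<bar>"
    using eventually_le_at_bot[of t] by eventually_elim auto
  then show ?thesis using eventually_happens'[of at_bot] trivial_limit_at_bot_linorder by blast
qed

lemma matched_scale: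
  assumes "\<rho> = 1 \<or> \<rho> = (-1 :: real)"
  shows "matched ((\<lambda>(a, a'). (\<rho> * a, \<rho> * a')) ` C) x x' \<longleftrightarrow> matched C (\<rho> * x) (\<rho> * x')"
  using assms unfolding matched_def sgn_diff_eq_iff by (auto simp: less_le case_prod_unfold)

context
  fixes C and f g :: "real poly" and x x' \<sigma> :: real
  assumes C: "monotone_pairs C" and x: "matched C x x'" "x \<notin> fst ` C"
    and deriv: "signs_agree C (pderiv f) (pderiv g)"
    and deg: "0 < degree f" "0 < degree g"
    and ends: "\<forall>(a, a')\<in>C. sgn (poly f a) = sgn (poly g a')"
    and \<sigma>: "\<sigma> = sgn (poly (pderiv f) x)"
begin

text \<open>
  In the gap of \<open>x\<close> and in the matched gap of \<open>x'\<close>, \<open>f\<close> and \<open>g\<close> are strictly monotone in the same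
  direction \<open>\<sigma>\<close>, since the roots of the derivatives are cut points.
\<close>

lemma gap_slope_nonzero: "\<sigma> = 1 \<or> \<sigma> = -1"
proof -
  have "pderiv f \<noteq> 0" using deg(1) by (simp add: pderiv_eq_0_iff)
  then have "poly (pderiv f) x \<noteq> 0" using root_is_matched_point[OF C deriv] x(2) by blast
  then show ?thesis using \<sigma> by (auto simp: sgn_if)
qed

lemma gap_slope:
  "matched C y x' \<Longrightarrow> sgn (poly (pderiv f) y) = \<sigma>"
  "matched C x y' \<Longrightarrow> sgn (poly (pderiv g) y') = \<sigma>"
  using deriv x(1) \<sigma> unfolding signs_agree_def by metis+

lemma gap_increment:
  assumes "matched C y x'" "matched C z x'"
  shows "sgn (poly f z - poly f y) = sgn (z - y) * \<sigma>"
proof -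
  have *: "sgn (poly f z - poly f y) = \<sigma>"
    if "y < z" "matched C y x'" "matched C z x'" for y z
  proof -
    obtain w where w: "y < w" "w < z" "poly f z - poly f y = (z - y) * poly (pderiv f) w"
      using poly_MVT[OF \<open>y < z\<close>] by blast
    have "matched C w x'" using matched_between[OF that(2,3)] w by simp
    with w show ?thesis using gap_slope(1) by (simp add: sgn_mult)
  qed
  consider "y < z" | "y = z" | "z < y" by linarith
  then show ?thesis
  proof cases
    case 3
    have "sgn (poly f z - poly f y) = - sgn (poly f y - poly f z)"
      by (metis minus_diff_eq sgn_minus)
    with 3 *[of z y] assms show ?thesis by simp
  qed (use *[of y z] assms in auto)
qed

text \<open>
  The four cases (sign \<open>s\<close>, direction \<open>\<sigma>\<close>) reduce to a negative value of an increasing function: replace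
  \<open>f\<close> by the function \<open>t \<mapsto> - s * f (\<rho> * t)\<close> with \<open>\<rho> = - s * \<sigma>\<close>, which reflects the line if \<open>\<rho> = -1\<close>.
\<close>

lemma gap_sign_transfers:
  assumes y: "matched C y x'" "sgn (poly f y) = s" and s: "s = 1 \<or> s = -1"
  shows "\<exists>y'. matched C x y' \<and> sgn (poly g y') = s"
proof -
  define \<rho> where "\<rho> = - s * \<sigma>"
  have \<rho>: "\<rho> = 1 \<or> \<rho> = -1" using s gap_slope_nonzero by (auto simp: \<rho>_def)
  have \<rho>\<rho>: "\<rho> * (\<rho> * t) = t" for t using \<rho> by auto
  define D where "D = (\<lambda>(a, a'). (\<rho> * a, \<rho> * a')) ` C"
  have mD: "matched D u u' \<longleftrightarrow> matched C (\<rho> * u) (\<rho> * u')" for u u'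
    unfolding D_def by (rule matched_scale[OF \<rho>])
  have inner: "((\<lambda>t. - s * poly p (\<rho> * t)) has_real_derivative \<sigma> * poly (pderiv p) (\<rho> * t)) (at t)" for p t
  proof -
    have "((\<lambda>t. - s * poly p (\<rho> * t)) has_real_derivative - s * (poly (pderiv p) (\<rho> * t) * \<rho>)) (at t)"
      by (auto intro!: derivative_eq_intros DERIV_chain2[OF poly_DERIV])
    moreover have "- s * (c * \<rho>) = \<sigma> * c" for c using s by (auto simp: \<rho>_def)
    ultimately show ?thesis by simp
  qed
  have pos: "0 < \<sigma> * c" if "sgn c = \<sigma>" for c
    using that gap_slope_nonzero by (auto simp: sgn_if split: if_splits)
  have neg: "- s * c < 0 \<longleftrightarrow> sgn c = s" for c
    using s by (auto simp: sgn_if)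
  have "\<exists>y'. matched D (\<rho> * x) y' \<and> - s * poly g (\<rho> * y') < 0"
  proof (rule negative_value_transfers[where f = "\<lambda>t. - s * poly f (\<rho> * t)"
        and f' = "\<lambda>t. \<sigma> * poly (pderiv f) (\<rho> * t)" and g = "\<lambda>t. - s * poly g (\<rho> * t)"
        and g' = "\<lambda>t. \<sigma> * poly (pderiv g) (\<rho> * t)" and x' = "\<rho> * x'" and y = "\<rho> * y"])
    show "((\<lambda>t. - s * poly f (\<rho> * t)) has_real_derivative \<sigma> * poly (pderiv f) (\<rho> * t)) (at t)" for t
      by (rule inner)
    show "((\<lambda>t. - s * poly g (\<rho> * t)) has_real_derivative \<sigma> * poly (pderiv g) (\<rho> * t)) (at t)" for t
      by (rule inner)
    show "monotone_pairs D" using C unfolding monotone_pairs_def by (auto simp: D_def matched_scale[OF \<rho>] \<rho>\<rho>)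
    show "matched D (\<rho> * x) (\<rho> * x')" "matched D (\<rho> * y) (\<rho> * x')"
      using x y by (simp_all add: mD \<rho>\<rho>)
    show "\<rho> * x \<notin> fst ` D"
    proof
      assume "\<rho> * x \<in> fst ` D"
      then obtain a a' where "(a, a') \<in> C" "\<rho> * x = \<rho> * a" by (auto simp: D_def)
      with \<rho> have "(x, a') \<in> C" by auto
      with x(2) show False by force
    qed
    show "0 < \<sigma> * poly (pderiv f) (\<rho> * u)" if "matched D u (\<rho> * x')" for u
      using that by (intro pos gap_slope) (simp add: mD \<rho>\<rho>)
    show "0 < \<sigma> * poly (pderiv g) (\<rho> * u)" if "matched D (\<rho> * x) u" for u
      using that by (intro pos gap_slope) (simp add: mD \<rho>\<rho>)
    show "\<exists>u\<le>t. \<bar>- s * poly g (\<rho> * t)\<bar> < \<bar>- s * poly g (\<rho> * u)\<bar>" for t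
      using poly_unbounded_along_ray[OF deg(2) \<rho>, of t] s by (auto simp: abs_mult)
    show "- s * poly g (\<rho> * a') < 0" if "(a, a') \<in> D" "- s * poly f (\<rho> * a) < 0" for a a'
      using that unfolding neg using ends by (auto simp: D_def \<rho>\<rho>)
    show "- s * poly f (\<rho> * (\<rho> * y)) < 0"
      unfolding neg \<rho>\<rho> by (rule y(2))
  qed
  then show ?thesis unfolding neg mD \<rho>\<rho> by blast
qed

text \<open>
  A strictly monotone function takes both signs around a root, because gaps are open.
\<close>

lemma gap_root_signs:
  assumes r: "matched C r x'" "poly f r = 0" and s: "s = 1 \<or> s = -1"
  shows "\<exists>y. matched C y x' \<and> sgn (poly f y) = s"
proof -
  have "finite (C\<inverse>)" using C by (simp add: monotone_pairs_def)
  moreover have "matched (C\<inverse>) x' r" using r(1) by (simp add: matched_converse)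
  moreover have "r \<notin> snd ` C\<inverse>"
  proof
    assume "r \<in> snd ` C\<inverse>"
    then obtain a' where "(r, a') \<in> C" by force
    with matched_point[OF r(1) this] have "x' = a'" by simp
    with \<open>(r, a') \<in> C\<close> matched_point[OF x(1)] x(2) show False by force
  qed
  ultimately obtain e where e: "e > 0" "\<forall>y. \<bar>y - r\<bar> < e \<longrightarrow> matched C y x'"
    using matched_neighbourhood[of "C\<inverse>" x' r] by (auto simp: matched_converse)
  define y where "y = r + s * \<sigma> * (e / 2)"
  have ss: "s * \<sigma> = 1 \<or> s * \<sigma> = -1" using s gap_slope_nonzero by auto
  then have m: "matched C y x'" using e by (auto simp: y_def)
  have "sgn (poly f y) = sgn (y - r) * \<sigma>"
    using gap_increment[OF r(1) m] r(2) by simp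
  also have "sgn (y - r) = s * \<sigma>" using ss e(1) by (auto simp: y_def)
  also have "s * \<sigma> * \<sigma> = s" using gap_slope_nonzero by auto
  finally show ?thesis using m by blast
qed

lemma gap_sign_at:
  assumes "matched C r x'" "poly f r = 0" "matched C y x'"
  shows "sgn (poly f y) = sgn (y - r) * \<sigma>"
  using gap_increment[OF assms(1,3)] assms(2) by simp

lemma gap_root_unique:
  assumes "matched C r x'" "poly f r = 0" "matched C y x'" "poly f y = 0"
  shows "y = r"
  using gap_sign_at[OF assms(1-3)] assms(4) gap_slope_nonzero by (auto simp: sgn_0_0)

end

section \<open>Adding a polynomial to a sign diagram\<close>

lemma monotone_pairsI:
  assumes "finite C"
    and "\<And>a a' b b'. (a, a') \<in> C \<Longrightarrow> (b, b') \<in> C \<Longrightarrow> sgn (a - b) = sgn (a' - b')"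
  shows "monotone_pairs C"
  unfolding monotone_pairs_def matched_def using assms by fast

text \<open>
  On each gap \<open>f\<close> has at most one root, and it has one exactly if it takes both signs there. The same
  holds for \<open>g\<close> on the matched gap, and by \<open>gap_sign_transfers\<close> both take the same signs. Pairing the
  roots and adding them as cut points makes the signs of \<open>f\<close> and \<open>g\<close> agree everywhere.
\<close>

lemma sign_extension:
  assumes C: "monotone_pairs C" and deriv: "signs_agree C (pderiv f) (pderiv g)"
    and deg: "0 < degree f" "0 < degree g"
    and ends: "\<forall>(a, a')\<in>C. sgn (poly f a) = sgn (poly g a')"
  shows "\<exists>D. monotone_pairs D \<and> C \<subseteq> D \<and> signs_agree D f g \<and> (\<forall>(a, a')\<in>D. (a, a') \<in> C \<or> poly f a = 0)"
proof -
  define N where "N = {(r, r'). r \<notin> fst ` C \<and> matched C r r' \<and> poly f r = 0 \<and> poly g r' = 0}"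
  have Cc: "monotone_pairs (C\<inverse>)" and derivc: "signs_agree (C\<inverse>) (pderiv g) (pderiv f)"
    and endsc: "\<forall>(a', a)\<in>C\<inverse>. sgn (poly g a') = sgn (poly f a)"
    using C deriv ends by (auto simp: monotone_pairs_converse signs_agree_converse)
  have off: "x' \<notin> fst ` (C\<inverse>)" if "matched C x x'" "x \<notin> fst ` C" for x x'
    using matched_not_point[OF that] by force
  note unique = gap_root_unique[OF C _ _ deriv deg ends refl]
  note unique' = gap_root_unique[OF Cc _ _ derivc deg(2,1) endsc refl, unfolded matched_converse]
  note sign_at = gap_sign_at[OF C _ _ deriv deg ends refl]
  note sign_at' = gap_sign_at[OF Cc _ _ derivc deg(2,1) endsc refl, unfolded matched_converse]
  note signs = gap_root_signs[OF C _ _ deriv deg ends refl]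
  note signs' = gap_root_signs[OF Cc _ _ derivc deg(2,1) endsc refl, unfolded matched_converse]
  note transfers = gap_sign_transfers[OF C _ _ deriv deg ends refl]
  note transfers' = gap_sign_transfers[OF Cc _ _ derivc deg(2,1) endsc refl, unfolded matched_converse]
  \<comment> \<open>Two new pairs either belong to the same gap and coincide, or are separated by an old pair.\<close>
  have NN: "sgn (r - s) = sgn (r' - s')" if r: "(r, r') \<in> N" and s: "(s, s') \<in> N" for r r' s s'
  proof (cases "matched C s r'")
    case True
    have r0: "matched C r r'" "r \<notin> fst ` C" "poly f r = 0" "poly g r' = 0" using r by (auto simp: N_def)
    have s0: "matched C s s'" "s \<notin> fst ` C" "poly f s = 0" "poly g s' = 0" using s by (auto simp: N_def)
    have "s = r" using unique[OF r0(1,2) r0(1,3) True s0(3)] .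
    moreover from this have "s' = r'"
      using unique'[OF r0(1) off[OF r0(1,2)] r0(1,4)] s0 by blast
    ultimately show ?thesis by simp
  next
    case False
    then obtain a a' where a: "(a, a') \<in> C" "sgn (s - a) \<noteq> sgn (r' - a')" by (auto simp: matched_def)
    have "matched C r r'" "matched C s s'" "r \<notin> fst ` C" "s \<notin> fst ` C" using r s by (auto simp: N_def)
    moreover from this have "r \<noteq> a" "s \<noteq> a" using a(1) by force+
    ultimately show ?thesis using a(2) matchedD[of C r r' a a'] matchedD[of C s s' a a'] a(1)
      unfolding sgn_diff_eq_iff by linarith
  qed
  have fg: "f \<noteq> 0" "g \<noteq> 0" using deg by auto
  have "finite ({r. poly f r = 0} \<times> {r. poly g r = 0})"
    using poly_roots_finite fg by blast
  then have "finite N" by (rule finite_subset[rotated]) (auto simp: N_def)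
  then have fin: "finite (C \<union> N)" using C by (simp add: monotone_pairs_def)
  have CN: "sgn (r - a) = sgn (r' - a')" if "(r, r') \<in> C \<union> N" "(a, a') \<in> C" for r r' a a'
    using that C by (auto simp: N_def dest: monotone_pairsD matchedD)
  have D: "monotone_pairs (C \<union> N)"
  proof (rule monotone_pairsI[OF fin])
    fix a a' b b' assume ab: "(a, a') \<in> C \<union> N" "(b, b') \<in> C \<union> N"
    then consider "(b, b') \<in> C" | "(a, a') \<in> C" | "(a, a') \<in> N" "(b, b') \<in> N" by blast
    then show "sgn (a - b) = sgn (a' - b')"
    proof cases
      case 2
      then have "sgn (b - a) = sgn (b' - a')" using CN ab by blast
      then show ?thesis by (metis minus_diff_eq sgn_minus)
    qed (use CN NN ab in blast)+
  qed
  have "signs_agree (C \<union> N) f g"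
    unfolding signs_agree_def
  proof (intro allI impI)
    \<comment> \<open>At an old cut point the signs agree by assumption; otherwise \<open>y\<close> and \<open>y'\<close> lie in matched gaps of \<open>C\<close>.\<close>
    fix y y' assume m: "matched (C \<union> N) y y'"
    then have y: "matched C y y'" by (rule matched_subset) simp
    show "sgn (poly f y) = sgn (poly g y')"
    proof (cases "y \<in> fst ` C")
      case True
      then obtain a' where a': "(y, a') \<in> C" by force
      with matched_point[OF y a'] ends show ?thesis by auto
    next
      case False
      note y' = off[OF y False]
      note slope = deriv[unfolded signs_agree_def, rule_format, OF y]
      have opp: "\<exists>r'. matched C y r' \<and> poly g r' = 0"
        if "matched C y u" "sgn (poly g u) = s" "matched C y v" "sgn (poly g v) \<noteq> s" for u v s
      proof -
        have ne: "sgn (poly g u) \<noteq> sgn (poly g v)" using that by simp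
        obtain r' where "u \<le> r' \<and> r' \<le> v \<or> v \<le> r' \<and> r' \<le> u" "poly g r' = 0"
          using sign_change_root[OF ne] by blast
        then show ?thesis
          using matched_between'[OF that(1,3)] matched_between'[OF that(3,1)] by blast
      qed
      have opp': "\<exists>r. matched C r y' \<and> poly f r = 0"
        if "matched C u y'" "sgn (poly f u) = s" "matched C v y'" "sgn (poly f v) \<noteq> s" for u v s
      proof -
        have ne: "sgn (poly f u) \<noteq> sgn (poly f v)" using that by simp
        obtain r where "u \<le> r \<and> r \<le> v \<or> v \<le> r \<and> r \<le> u" "poly f r = 0"
          using sign_change_root[OF ne] by blast
        then show ?thesis
          using matched_between[OF that(1,3)] matched_between[OF that(3,1)] by blast
      qed
      show ?thesis
      proof (cases "\<exists>r. matched C r y' \<and> poly f r = 0")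
        case True
        then obtain r where r: "matched C r y'" "poly f r = 0" by blast
        obtain u v where "matched C u y'" "sgn (poly f u) = 1" "matched C v y'" "sgn (poly f v) = -1"
          using signs[OF y False r] by blast
        then obtain u' v' where "matched C y u'" "sgn (poly g u') = 1" "matched C y v'" "sgn (poly g v') = -1"
          using transfers[OF y False] by blast
        then obtain r' where r': "matched C y r'" "poly g r' = 0"
          using opp[of u' 1 v'] by auto
        have "matched C r r'"
          using y r(1) r'(1) unfolding matched_def by (auto split: prod.splits)
        moreover have "r \<notin> fst ` C"
          using matched_not_point[of "C\<inverse>" y' r] y' r(1) by (force simp: matched_converse)
        ultimately have "(r, r') \<in> C \<union> N" using r r' by (simp add: N_def)
        then have "sgn (y - r) = sgn (y' - r')" by (rule matchedD[OF m])
        then show ?thesis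
          using sign_at[OF y False r y] sign_at'[OF y y' r' y] slope by simp
      next
        case False
        note no_root = False
        define s where "s = sgn (poly f y)"
        have s: "s = 1 \<or> s = -1" using no_root y by (auto simp: s_def sgn_if)
        obtain u' where u': "matched C y u'" "sgn (poly g u') = s"
          using transfers[OF y \<open>y \<notin> fst ` C\<close> y _ s] s_def by blast
        show ?thesis
        proof (rule ccontr)
          assume "sgn (poly f y) \<noteq> sgn (poly g y')"
          then have "sgn (poly g y') \<noteq> s" by (simp add: s_def)
          then obtain r' where r': "matched C y r'" "poly g r' = 0" using opp[OF u' y] by blast
          have s': "- s = 1 \<or> - s = -1" using s by auto
          obtain v' where v': "matched C y v'" "sgn (poly g v') = - s"
            using signs'[OF y y' r' s'] by blast
          obtain v where v: "matched C v y'" "sgn (poly f v) = - s"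
            using transfers'[OF y y' v' s'] by blast
          with opp'[OF y s_def[symmetric] v(1)] s no_root show False by auto
        qed
      qed
    qed
  qed
  with D show ?thesis by (intro exI[of _ "C \<union> N"]) (auto simp: N_def)
qed

section \<open>Sign diagrams of polynomials with parameters\<close>

text \<open>
  The bound \<open>n\<close> on the number of coefficients is formal and the same for all parameters \<open>e\<close>, so that an
  induction on it is possible. At some parameters the degree may be smaller than \<open>n - 1\<close>.
\<close>

definition poly_family :: "nat \<Rightarrow> ('a::real_normed_vector \<Rightarrow> real poly) \<Rightarrow> bool" where
  "poly_family n p \<longleftrightarrow> (\<forall>i. real_polynomial_function (\<lambda>e. coeff (p e) i)) \<and>
     (\<forall>e i. n \<le> i \<longrightarrow> coeff (p e) i = 0)"

definition same_signs :: "('a \<Rightarrow> real) set \<Rightarrow> 'a \<Rightarrow> 'a \<Rightarrow> bool" where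
  "same_signs Q e e' \<longleftrightarrow> (\<forall>q\<in>Q. sgn (q e) = sgn (q e'))"

definition specialise :: "('a \<Rightarrow> real poly) set \<Rightarrow> 'a \<Rightarrow> 'a \<Rightarrow> (real poly \<times> real poly) set" where
  "specialise F e e' = (\<lambda>p. (p e, p e')) ` F"

text \<open>
  One step of division with remainder, cleared of denominators: if \<open>g e\<close> has degree \<open>k\<close>, the top terms
  of \<open>p\<close> and of a multiple of \<open>g\<close> cancel. The cutoff makes the formal degree drop also at parameters
  where \<open>g e\<close> has a degree other than \<open>k\<close>.
\<close>

definition cancel_top :: "nat \<Rightarrow> ('a \<Rightarrow> real poly) \<Rightarrow> nat \<Rightarrow> ('a \<Rightarrow> real poly) \<Rightarrow> 'a \<Rightarrow> real poly" where
  "cancel_top n p k g e = smult (coeff (g e) k) (p e)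
     - monom (coeff (p e) n) (n - k) * poly_cutoff (Suc k) (g e)"

lemma poly_family_mono: "poly_family m p \<Longrightarrow> m \<le> n \<Longrightarrow> poly_family n p"
  by (auto simp: poly_family_def)

lemma poly_family_pderiv:
  assumes "poly_family (Suc n) p"
  shows "poly_family n (\<lambda>e. pderiv (p e))"
  using assms unfolding poly_family_def by (auto simp: coeff_pderiv)

lemma poly_family_cutoff:
  assumes "poly_family m p"
  shows "poly_family n (\<lambda>e. poly_cutoff n (p e))"
  unfolding poly_family_def
proof (intro conjI allI impI)
  fix i
  show "real_polynomial_function (\<lambda>e. coeff (poly_cutoff n (p e)) i)"
    using assms by (cases "i < n") (auto simp: coeff_poly_cutoff poly_family_def)
qed (simp add: coeff_poly_cutoff)

lemma poly_family_cancel_top: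
  assumes p: "poly_family (Suc n) p" and g: "poly_family (Suc n) g" and "k \<le> n"
  shows "poly_family n (cancel_top n p k g)"
  unfolding poly_family_def
proof (intro conjI allI impI)
  have "real_polynomial_function (\<lambda>e. coeff (poly_cutoff (Suc k) (g e)) i)" for i
    using poly_family_cutoff[OF g] unfolding poly_family_def by blast
  then show "real_polynomial_function (\<lambda>e. coeff (cancel_top n p k g e) i)" for i
    using p g unfolding cancel_top_def coeff_diff coeff_smult coeff_monom_mult poly_family_def
    by (cases "i < n - k")
      (simp_all add: real_polynomial_function.intros(4) real_polynomial_function_diff)
next
  fix e i assume "n \<le> i"
  then show "coeff (cancel_top n p k g e) i = 0"
    using p \<open>k \<le> n\<close> unfolding poly_family_def
    by (cases "i = n") (auto simp: cancel_top_def coeff_monom_mult coeff_poly_cutoff)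
qed

text \<open>
  At a root of \<open>g\<close> the reduced polynomial shows the sign of \<open>p\<close>, given the sign of the leading
  coefficient of \<open>g\<close>.
\<close>

lemma poly_cancel_top:
  assumes "degree (g e) = k" "poly (g e) a = 0"
  shows "poly (cancel_top n p k g e) a = lead_coeff (g e) * poly (p e) a"
proof -
  have "poly_cutoff (Suc k) (g e) = g e"
    using assms(1) by (auto simp: poly_eq_iff coeff_poly_cutoff coeff_eq_0)
  then show ?thesis using assms by (simp add: cancel_top_def)
qed

lemma degree_eq_if_same_support:
  assumes "\<And>i. coeff f i = 0 \<longleftrightarrow> coeff g i = 0"
  shows "degree f = degree g"
  unfolding degree_def using assms by simp

lemma same_signs_family:
  assumes g: "poly_family (Suc n) g" and s: "\<forall>i\<le>n. sgn (coeff (g e) i) = sgn (coeff (g e') i)"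
  shows "sgn (coeff (g e) i) = sgn (coeff (g e') i)" "degree (g e) = degree (g e')"
proof -
  show *: "sgn (coeff (g e) i) = sgn (coeff (g e') i)" for i
    using g s by (cases "i \<le> n") (auto simp: poly_family_def)
  show "degree (g e) = degree (g e')"
    using * by (intro degree_eq_if_same_support) (metis sgn_0_0)
qed

lemma degree_poly_family: "poly_family (Suc n) g \<Longrightarrow> degree (g e) \<le> n"
  by (intro degree_le) (auto simp: poly_family_def)

text \<open>
  The inductive step of the Cohen--Hormander elimination: a diagram for the derivative of \<open>p\<close>, for \<open>p\<close>
  without its top term and for all reductions of \<open>p\<close> can be extended by \<open>p\<close> itself. If the top
  coefficient vanishes, \<open>p\<close> is its cutoff. Otherwise \<open>p\<close> is monotone between the roots of the family,
  and its signs at these roots are determined by those of the reductions.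
\<close>

lemma sign_diagram_insert:
  assumes C': "sign_diagram C' (specialise F' e e')" and sub: "F \<subseteq> F'"
    and pd: "(\<lambda>e. pderiv (p e)) \<in> F" and cut: "(\<lambda>e. poly_cutoff n (p e)) \<in> F"
    and rem: "\<And>g k. g \<in> F \<Longrightarrow> k \<le> n \<Longrightarrow> cancel_top n p k g \<in> F'"
    and fam: "\<And>g. g \<in> insert p F \<Longrightarrow> poly_family (Suc n) g"
    and signs: "\<And>g. g \<in> insert p F \<Longrightarrow> \<forall>i\<le>n. sgn (coeff (g e) i) = sgn (coeff (g e') i)"
  shows "\<exists>D. sign_diagram D (specialise (insert p F) e e')"
proof -
  have "specialise F e e' \<subseteq> specialise F' e e'" using sub by (auto simp: specialise_def)
  \<comment> \<open>The reductions contribute their signs on \<open>C'\<close>, but their roots must not remain cut points,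
    because the signs of \<open>p\<close> at these are unknown.\<close>
  then obtain C where C: "C \<subseteq> C'" "sign_diagram C (specialise F e e')"
    using sign_diagram_restrict[OF C'] by blast
  have ch: "monotone_pairs C" "monotone_pairs C'" using C(2) C' by (auto simp: sign_diagram_def)
  have ag: "signs_agree C (g e) (g e')" if "g \<in> F" for g
    using C(2) that by (auto simp: sign_diagram_def specialise_def)
  have ag': "signs_agree C' (g e) (g e')" if "g \<in> F'" for g
    using C' that by (auto simp: sign_diagram_def specialise_def)
  have roots: "\<exists>g\<in>F. g e \<noteq> 0 \<and> poly (g e) a = 0" if "(a, a') \<in> C" for a a'
    using C(2) that by (fastforce simp: sign_diagram_def specialise_def)
  have easy: ?thesis if "signs_agree C (p e) (p e')"
    using C(2) that by (intro exI[of _ C]) (auto simp: sign_diagram_def specialise_def)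
  note p = fam[of p, simplified]
  note coeffs = same_signs_family(1)[OF p signs[of p, simplified]]
  note deg = same_signs_family(2)[OF p signs[of p, simplified]]
  have dn: "degree (p e) \<le> n" by (rule degree_poly_family[OF p])
  show ?thesis
  proof (cases "coeff (p e) n = 0")
    case True
    then have "coeff (p e') n = 0" using coeffs[of n] by (metis sgn_0_0)
    have cutoff: "poly_cutoff n (p u) = p u" if "coeff (p u) n = 0" for u
      using p that by (auto simp: poly_eq_iff coeff_poly_cutoff poly_family_def)
        (metis le_neq_implies_less linorder_not_less not_less_eq_eq)
    show ?thesis using ag[OF cut] cutoff[OF True] cutoff[OF \<open>coeff (p e') n = 0\<close>] easy by simp
  next
    case False
    then have n: "degree (p e) = n" using dn le_degree by fastforce
    show ?thesis
    proof (cases n)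
      case 0
      then have "p e = [:coeff (p e) 0:]" "p e' = [:coeff (p e') 0:]"
        using n deg degree_0_id by metis+
      then have "poly (p e) x = coeff (p e) 0" "poly (p e') x = coeff (p e') 0" for x
        by (metis mult_zero_right poly_0 poly_pCons add.right_neutral)+
      then show ?thesis using coeffs[of 0] by (intro easy) (simp add: signs_agree_def)
    next
      case (Suc m)
      have ends: "\<forall>(a, a')\<in>C. sgn (poly (p e) a) = sgn (poly (p e') a')"
      proof clarify
        fix a a' assume a: "(a, a') \<in> C"
        with roots obtain g where g: "g \<in> F" "g e \<noteq> 0" "poly (g e) a = 0" by blast
        have m: "matched C a a'" "matched C' a a'" using a C(1) ch monotone_pairsD by blast+
        have g': "poly (g e') a' = 0" using signs_agree_root_iff[OF ag[OF g(1)] m(1)] g(3) by simp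
        define k where "k = degree (g e)"
        have gf: "poly_family (Suc n) g" using fam g(1) by simp
        note gs = signs[of g, OF insertI2, OF g(1)]
        have k: "degree (g e') = k" "k \<le> n"
          using same_signs_family(2)[OF gf gs] degree_poly_family[OF gf] by (auto simp: k_def)
        have lc: "sgn (coeff (g e) k) = sgn (coeff (g e') k)" using gs k by simp
        have nz: "sgn (coeff (g e) k) \<noteq> 0" using g(2) by (simp add: k_def sgn_0_0)
        have "sgn (poly (cancel_top n p k g e) a) = sgn (poly (cancel_top n p k g e') a')"
          using ag'[OF rem[OF g(1) k(2)]] m(2) by (simp add: signs_agree_def)
        then have "sgn (coeff (g e) k) * sgn (poly (p e) a) = sgn (coeff (g e') k) * sgn (poly (p e') a')"
          using poly_cancel_top[of g e k a n p] poly_cancel_top[of g e' k a' n p] g g' k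
          by (simp add: k_def sgn_mult)
        then show "sgn (poly (p e) a) = sgn (poly (p e') a')"
          using lc nz by simp
      qed
      obtain D where D: "monotone_pairs D" "C \<subseteq> D" "signs_agree D (p e) (p e')"
          "\<forall>(a, a')\<in>D. (a, a') \<in> C \<or> poly (p e) a = 0"
        using sign_extension[OF ch(1) ag[OF pd] _ _ ends] n deg Suc by auto
      have "signs_agree D (g e) (g e')" if "g \<in> F" for g
        using ag[OF that] matched_subset[OF _ D(2)] unfolding signs_agree_def by blast
      moreover have "p e \<noteq> 0" using False by auto
      ultimately have "sign_diagram D (specialise (insert p F) e e')"
        using D roots unfolding sign_diagram_def specialise_def by fastforce
      then show ?thesis ..
    qed
  qed
qed

lemma sign_diagram_mono:
  assumes "sign_diagram C (specialise F e e')" "F0 \<subseteq> F"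
  shows "\<exists>C0. sign_diagram C0 (specialise F0 e e')"
  using sign_diagram_restrict[OF assms(1), of "specialise F0 e e'"] assms(2)
  by (auto simp: specialise_def)

text \<open>
  Only finitely many polynomial conditions on the parameter decide how the roots of all members of the
  family are ordered and which signs occur between them. The induction is on the formal degree \<open>n\<close>, and
  for fixed \<open>n\<close> on the set \<open>H\<close> of polynomials of top degree: removing one of them brings in only
  polynomials of lower degree (its derivative, its cutoff and its reductions), which go into \<open>G\<close>.
\<close>

theorem sign_diagram_determined_by_coefficients:
  fixes F :: "('a::real_normed_vector \<Rightarrow> real poly) set"
  assumes "finite F" "\<And>p. p \<in> F \<Longrightarrow> poly_family n p"
  shows "\<exists>Q. finite Q \<and> (\<forall>q\<in>Q. real_polynomial_function q) \<and>
    (\<forall>e e'. same_signs Q e e' \<longrightarrow> (\<exists>C. sign_diagram C (specialise F e e')))"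
  using assms
proof (induction n arbitrary: F)
  case 0
  have "p = (\<lambda>e. 0)" if "p \<in> F" for p
    using 0(2)[OF that] by (simp add: poly_family_def poly_eq_iff fun_eq_iff)
  then have "sign_diagram {} (specialise F e e')" for e e'
    by (force simp: sign_diagram_def monotone_pairs_def signs_agree_def specialise_def)
  then show ?case by (intro exI[of _ "{}"]) auto
next
  case (Suc n)
  have "\<exists>Q. finite Q \<and> (\<forall>q\<in>Q. real_polynomial_function q) \<and>
      (\<forall>e e'. same_signs Q e e' \<longrightarrow> (\<exists>C. sign_diagram C (specialise (G \<union> H) e e')))"
    if "finite H" "\<And>p. p \<in> H \<Longrightarrow> poly_family (Suc n) p"
      "finite G" "\<And>p. p \<in> G \<Longrightarrow> poly_family n p" for G H :: "('a \<Rightarrow> real poly) set"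
    using that
  proof (induction H arbitrary: G rule: finite_induct)
    case empty
    then show ?case using Suc.IH[of G] by simp
  next
    case (insert p H)
    have p: "poly_family (Suc n) p" using insert.prems by simp
    define S where "S = {\<lambda>e. pderiv (p e), \<lambda>e. poly_cutoff n (p e)}"
    define F where "F = S \<union> G \<union> H"
    define R where "R = (\<lambda>(g, k). cancel_top n p k g) ` (F \<times> {..n})"
    have S: "poly_family n g" if "g \<in> S" for g
      using that poly_family_pderiv[OF p] poly_family_cutoff[OF p] by (auto simp: S_def)
    have fam: "poly_family (Suc n) g" if "g \<in> insert p F" for g
      using that S insert.prems poly_family_mono[of n _ "Suc n"] by (auto simp: F_def)
    have finF: "finite F" using insert by (simp add: F_def S_def)
    then have finR: "finite R" by (simp add: R_def)
    have R: "poly_family n g" if "g \<in> R" for g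
      using that fam by (auto simp: R_def intro!: poly_family_cancel_top)
    have "\<exists>Q. finite Q \<and> (\<forall>q\<in>Q. real_polynomial_function q) \<and>
        (\<forall>e e'. same_signs Q e e' \<longrightarrow> (\<exists>C. sign_diagram C (specialise ((S \<union> G \<union> R) \<union> H) e e')))"
      using insert.prems S R finR by (intro insert.IH) (auto simp: S_def)
    then obtain Q where Q: "finite Q" "\<forall>q\<in>Q. real_polynomial_function q"
      "\<And>e e'. same_signs Q e e' \<Longrightarrow> \<exists>C. sign_diagram C (specialise ((S \<union> G \<union> R) \<union> H) e e')"
      by blast
    define Q' where "Q' = Q \<union> (\<lambda>(g, i) e. coeff (g e) i) ` (insert p F \<times> {..n})"
    have "\<exists>C. sign_diagram C (specialise (G \<union> insert p H) e e')" if "same_signs Q' e e'" for e e'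
    proof -
      have "same_signs Q e e'" using that by (auto simp: same_signs_def Q'_def)
      then obtain C where C: "sign_diagram C (specialise ((S \<union> G \<union> R) \<union> H) e e')"
        using Q(3) by blast
      have coeffs: "\<forall>i\<le>n. sgn (coeff (g e) i) = sgn (coeff (g e') i)" if "g \<in> insert p F" for g
      proof (intro allI impI)
        fix i assume "i \<le> n"
        then have "(\<lambda>e. coeff (g e) i) \<in> Q'" using that unfolding Q'_def
          by (intro UnI2 image_eqI[of _ _ "(g, i)"]) auto
        with \<open>same_signs Q' e e'\<close> show "sgn (coeff (g e) i) = sgn (coeff (g e') i)"
          by (auto simp: same_signs_def)
      qed
      have "\<exists>D. sign_diagram D (specialise (insert p F) e e')"
        by (rule sign_diagram_insert[OF C _ _ _ _ fam coeffs]) (auto simp: F_def S_def R_def)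
      then show ?thesis by (metis sign_diagram_mono F_def Un_insert_right Un_assoc sup_ge2)
    qed
    moreover have "finite Q'" using Q(1) finF by (simp add: Q'_def)
    moreover have "\<forall>q\<in>Q'. real_polynomial_function q"
      using Q(2) fam by (auto simp: Q'_def poly_family_def)
    ultimately show ?case by blast
  qed
  from this[of F "{}"] Suc.prems show ?case by simp
qed

section \<open>Semialgebraic predicates and elimination of quantifiers\<close>

text \<open>
  To depend only on the signs of finitely many polynomial functions is the same as to be a Boolean
  combination of polynomial inequalities. In this form Boolean operations only
  collect polynomials, and a quantifier can be eliminated by comparing two parameters instead of
  manipulating formulas.
\<close>

definition semialgebraic :: "('a::real_normed_vector \<Rightarrow> bool) \<Rightarrow> bool" where
  "semialgebraic \<phi> \<longleftrightarrow> (\<exists>Q. finite Q \<and> (\<forall>q\<in>Q. real_polynomial_function q) \<and>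
     (\<forall>e e'. same_signs Q e e' \<longrightarrow> \<phi> e = \<phi> e'))"

lemma semialgebraicI:
  assumes "finite Q" "\<And>q. q \<in> Q \<Longrightarrow> real_polynomial_function q"
    and "\<And>e e'. same_signs Q e e' \<Longrightarrow> \<phi> e = \<phi> e'"
  shows "semialgebraic \<phi>"
  using assms unfolding semialgebraic_def by blast

lemma semialgebraic_const: "semialgebraic (\<lambda>e. c)"
  unfolding semialgebraic_def by (rule exI[of _ "{}"]) simp

lemma semialgebraic_not: "semialgebraic \<phi> \<Longrightarrow> semialgebraic (\<lambda>e. \<not> \<phi> e)"
  by (simp add: semialgebraic_def)

lemma semialgebraic_Ball:
  assumes "finite I" "\<And>i. i \<in> I \<Longrightarrow> semialgebraic (\<phi> i)"
  shows "semialgebraic (\<lambda>e. \<forall>i\<in>I. \<phi> i e)"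
proof -
  have "\<forall>i\<in>I. \<exists>Q. finite Q \<and> (\<forall>q\<in>Q. real_polynomial_function q) \<and>
     (\<forall>e e'. same_signs Q e e' \<longrightarrow> \<phi> i e = \<phi> i e')"
    using assms(2) by (simp add: semialgebraic_def)
  then obtain Q where Q: "\<forall>i\<in>I. finite (Q i) \<and> (\<forall>q\<in>Q i. real_polynomial_function q) \<and>
     (\<forall>e e'. same_signs (Q i) e e' \<longrightarrow> \<phi> i e = \<phi> i e')"
    by (rule bchoice[THEN exE])
  have "(\<forall>i\<in>I. \<phi> i e) = (\<forall>i\<in>I. \<phi> i e')" if "same_signs (\<Union>i\<in>I. Q i) e e'" for e e'
  proof -
    have "same_signs (Q i) e e'" if "i \<in> I" for i
      using that \<open>same_signs (\<Union>i\<in>I. Q i) e e'\<close> unfolding same_signs_def by blast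
    then show ?thesis using Q by blast
  qed
  then show ?thesis
    unfolding semialgebraic_def using Q assms(1) by (intro exI[of _ "\<Union>i\<in>I. Q i"]) auto
qed

lemma semialgebraic_conj:
  assumes "semialgebraic \<phi>" "semialgebraic \<psi>"
  shows "semialgebraic (\<lambda>e. \<phi> e \<and> \<psi> e)"
proof -
  have "semialgebraic (\<lambda>e. \<forall>b\<in>{True, False}. (if b then \<phi> else \<psi>) e)"
    using assms by (intro semialgebraic_Ball) auto
  moreover have "(\<forall>b\<in>{True, False}. (if b then \<phi> else \<psi>) e) = (\<phi> e \<and> \<psi> e)" for e
    by auto
  ultimately show ?thesis by (simp only:)
qed

lemma semialgebraic_imp:
  assumes "semialgebraic \<phi>" "semialgebraic \<psi>"
  shows "semialgebraic (\<lambda>e. \<phi> e \<longrightarrow> \<psi> e)"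
proof -
  have "semialgebraic (\<lambda>e. \<not> (\<phi> e \<and> \<not> \<psi> e))"
    using assms by (intro semialgebraic_not semialgebraic_conj)
  then show ?thesis by simp
qed

lemma semialgebraic_iff_const:
  "semialgebraic \<phi> \<Longrightarrow> semialgebraic (\<lambda>e. \<phi> e \<longleftrightarrow> c)"
  by (cases c) (simp_all add: semialgebraic_not)

lemma semialgebraic_less:
  assumes "real_polynomial_function f" "real_polynomial_function g"
  shows "semialgebraic (\<lambda>e. f e < g e)"
proof -
  let ?q = "\<lambda>e. g e - f e"
  have "real_polynomial_function ?q"
    using assms by (rule real_polynomial_function_diff[rotated])
  moreover have "(f e < g e) = (f e' < g e')" if "same_signs {?q} e e'" for e e'
    using that by (auto simp: same_signs_def sgn_if split: if_splits)
  ultimately show ?thesis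
    by (intro semialgebraicI[of "{?q}"]) (assumption | simp)+
qed

lemma semialgebraic_le:
  assumes "real_polynomial_function f" "real_polynomial_function g"
  shows "semialgebraic (\<lambda>e. f e \<le> g e)"
proof -
  have "semialgebraic (\<lambda>e. \<not> g e < f e)"
    by (intro semialgebraic_not semialgebraic_less assms)
  then show ?thesis by (simp add: not_less)
qed

lemma semialgebraic_eq:
  assumes "real_polynomial_function f" "real_polynomial_function g"
  shows "semialgebraic (\<lambda>e. f e = g e)"
proof -
  have "semialgebraic (\<lambda>e. f e \<le> g e \<and> g e \<le> f e)"
    by (rule semialgebraic_conj[OF semialgebraic_le[OF assms] semialgebraic_le[OF assms(2,1)]])
  moreover have "(f e \<le> g e \<and> g e \<le> f e) = (f e = g e)" for e by auto
  ultimately show ?thesis by (simp only:)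
qed

lemma semialgebraic_vec_eq:
  fixes f g :: "'a::real_normed_vector \<Rightarrow> real^'n"
  assumes "\<And>i. real_polynomial_function (\<lambda>e. f e $ i)" "\<And>i. real_polynomial_function (\<lambda>e. g e $ i)"
  shows "semialgebraic (\<lambda>e. f e = g e)"
proof -
  have "semialgebraic (\<lambda>e. \<forall>i\<in>UNIV. f e $ i = g e $ i)"
    by (intro semialgebraic_Ball semialgebraic_eq assms) simp
  then show ?thesis by (simp add: vec_eq_iff)
qed

lemma semialgebraic_compose:
  assumes "semialgebraic \<phi>" "polynomial_function h"
  shows "semialgebraic (\<lambda>e. \<phi> (h e))"
proof -
  obtain Q where Q: "finite Q" "\<forall>q\<in>Q. real_polynomial_function q"
    "\<forall>e e'. same_signs Q e e' \<longrightarrow> \<phi> e = \<phi> e'"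
    using assms(1) unfolding semialgebraic_def by blast
  show ?thesis
  proof (rule semialgebraicI[of "(\<lambda>q. q \<circ> h) ` Q"])
    show "finite ((\<lambda>q. q \<circ> h) ` Q)" using Q(1) by simp
    show "real_polynomial_function q" if "q \<in> (\<lambda>q. q \<circ> h) ` Q" for q
      using that Q(2) real_polynomial_function_compose[OF assms(2)] by blast
    fix e e' assume "same_signs ((\<lambda>q. q \<circ> h) ` Q) e e'"
    then have "same_signs Q (h e) (h e')" by (simp add: same_signs_def)
    then show "\<phi> (h e) = \<phi> (h e')" using Q(3) by blast
  qed
qed

text \<open>
  This turns a real quantifier over motions in direction \<open>v\<close> into a question about the roots of univariate
  polynomials with parameters.
\<close>

lemma polynomial_along_line:
  fixes q :: "'a::real_normed_vector \<Rightarrow> real"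
  assumes "real_polynomial_function q"
  shows "\<exists>n p. poly_family n p \<and> (\<forall>e t. poly (p e) t = q (e + t *\<^sub>R v))"
  using assms
proof (induction q)
  case (linear f)
  have "poly_family 2 (\<lambda>e. [:f e, f v:])"
    unfolding poly_family_def
  proof (intro conjI allI impI)
    fix i :: nat
    consider "i = 0" | "i = 1" | "2 \<le> i" by linarith
    then show "real_polynomial_function (\<lambda>e. coeff [:f e, f v:] i)"
      using linear by cases
        (simp_all add: real_polynomial_function.intros(1,2) coeff_eq_0)
  next
    fix e and i :: nat assume "2 \<le> i"
    then show "coeff [:f e, f v:] i = 0" by (intro coeff_eq_0) auto
  qed
  moreover have "poly [:f e, f v:] t = f (e + t *\<^sub>R v)" for e t
    using linear by (simp add: linear_simps)
  ultimately show ?case by blast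
next
  case (const c)
  have "poly_family 1 (\<lambda>e::'a. [:c:])"
    unfolding poly_family_def by (simp add: coeff_eq_0 real_polynomial_function.intros(2))
  then show ?case by (intro exI[of _ 1] exI[of _ "\<lambda>e. [:c:]"]) auto
next
  case (add f g)
  then obtain m n p q where
    pq: "poly_family m p" "\<forall>e t. poly (p e) t = f (e + t *\<^sub>R v)"
      "poly_family n q" "\<forall>e t. poly (q e) t = g (e + t *\<^sub>R v)" by blast
  then have "poly_family (max m n) (\<lambda>e. p e + q e)"
    unfolding poly_family_def by (simp add: real_polynomial_function.intros(3))
  moreover have "poly (p e + q e) t = f (e + t *\<^sub>R v) + g (e + t *\<^sub>R v)" for e t
    using pq by simp
  ultimately show ?case by blast
next
  case (mult f g)
  then obtain m n p q where
    pq: "poly_family m p" "\<forall>e t. poly (p e) t = f (e + t *\<^sub>R v)"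
      "poly_family n q" "\<forall>e t. poly (q e) t = g (e + t *\<^sub>R v)" by blast
  have "poly_family (m + n) (\<lambda>e. p e * q e)"
    unfolding poly_family_def
  proof (intro conjI allI impI)
    show "real_polynomial_function (\<lambda>e. coeff (p e * q e) i)" for i
      using pq(1,3) unfolding coeff_mult poly_family_def
      by (intro real_polynomial_function_sum real_polynomial_function.intros(4)) simp_all
    fix e i assume i: "m + n \<le> i"
    have "coeff (p e) j * coeff (q e) (i - j) = 0" for j
      using pq(1,3) i by (cases "m \<le> j") (auto simp: poly_family_def)
    then show "coeff (p e * q e) i = 0" unfolding coeff_mult by (intro sum.neutral ballI)
  qed
  moreover have "poly (p e * q e) t = f (e + t *\<^sub>R v) * g (e + t *\<^sub>R v)" for e t
    using pq by simp
  ultimately show ?case by blast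
qed

text \<open>
  Finitely many sign conditions on \<open>e\<close> and \<open>e'\<close> ensure that the polynomials, restricted to the lines
  through \<open>e\<close> and \<open>e'\<close> in direction \<open>v\<close>, share a sign diagram. A witness on the line through \<open>e\<close> then has a matched point on the
  line through \<open>e'\<close> where all polynomials have the same signs.
\<close>

lemma semialgebraic_ex_direction:
  fixes \<phi> :: "'a::real_normed_vector \<Rightarrow> bool"
  assumes "semialgebraic \<phi>"
  shows "semialgebraic (\<lambda>e. \<exists>t. \<phi> (e + t *\<^sub>R v))"
proof -
  obtain Q where Q: "finite Q" "\<forall>q\<in>Q. real_polynomial_function q"
    "\<And>e e'. same_signs Q e e' \<Longrightarrow> \<phi> e = \<phi> e'"
    using assms unfolding semialgebraic_def by blast
  have "\<forall>q\<in>Q. \<exists>p. (\<exists>n. poly_family n p) \<and> (\<forall>e t. poly (p e) t = q (e + t *\<^sub>R v))"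
    using Q(2) polynomial_along_line by blast
  then obtain p where p: "\<forall>q\<in>Q. (\<exists>n. poly_family n (p q)) \<and> (\<forall>e t. poly (p q e) t = q (e + t *\<^sub>R v))"
    by (rule bchoice[THEN exE])
  then obtain n where n: "\<forall>q\<in>Q. poly_family (n q) (p q)" by metis
  have "\<exists>P. finite P \<and> (\<forall>q\<in>P. real_polynomial_function q) \<and>
    (\<forall>e e'. same_signs P e e' \<longrightarrow> (\<exists>C. sign_diagram C (specialise (p ` Q) e e')))"
  proof (rule sign_diagram_determined_by_coefficients)
    fix f assume "f \<in> p ` Q"
    then obtain q where q: "q \<in> Q" "f = p q" by blast
    then have "n q \<le> Max (n ` Q)" using Q(1) by simp
    with q n show "poly_family (Max (n ` Q)) f" using poly_family_mono by blast
  qed (use Q(1) in simp)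
  then obtain P where P: "finite P" "\<forall>q\<in>P. real_polynomial_function q"
    "\<And>e e'. same_signs P e e' \<Longrightarrow> \<exists>C. sign_diagram C (specialise (p ` Q) e e')"
    by blast
  have *: "\<exists>t. \<phi> (e' + t *\<^sub>R v)" if s: "same_signs P e e'" and t: "\<phi> (e + t *\<^sub>R v)" for e e' t
  proof -
    obtain C where C: "sign_diagram C (specialise (p ` Q) e e')" using P(3)[OF s] by blast
    obtain t' where t': "matched C t t'" using matched_exists C unfolding sign_diagram_def by blast
    have "sgn (q (e + t *\<^sub>R v)) = sgn (q (e' + t' *\<^sub>R v))" if "q \<in> Q" for q
    proof -
      have "signs_agree C (p q e) (p q e')"
        using C that by (auto simp: sign_diagram_def specialise_def)
      then show ?thesis using t' p that by (metis signs_agree_def)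
    qed
    then have "same_signs Q (e + t *\<^sub>R v) (e' + t' *\<^sub>R v)" by (simp add: same_signs_def)
    with t Q(3) show ?thesis by blast
  qed
  have "same_signs P e' e" if "same_signs P e e'" for e e'
    using that by (simp add: same_signs_def)
  with * have "(\<exists>t. \<phi> (e + t *\<^sub>R v)) = (\<exists>t. \<phi> (e' + t *\<^sub>R v))" if "same_signs P e e'" for e e'
    using that by blast
  with P(1,2) show ?thesis by (intro semialgebraicI[of P]) blast+
qed

text \<open>
  The Tarski--Seidenberg theorem for a vector variable: its coordinates are eliminated one at a time, as
  motions along the basis vectors.
\<close>

theorem semialgebraic_ex:
  fixes \<phi> :: "'a::real_normed_vector \<Rightarrow> 'b::euclidean_space \<Rightarrow> bool"
  assumes "semialgebraic (\<lambda>p. \<phi> (fst p) (snd p))"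
  shows "semialgebraic (\<lambda>e. \<exists>x. \<phi> e x)"
proof -
  have "semialgebraic (\<lambda>p. \<exists>w\<in>span K. \<phi> (fst p) (snd p + w))" if "finite K" for K
    using that
  proof (induction K rule: finite_induct)
    case empty
    with assms show ?case by simp
  next
    case (insert b K)
    have "(\<exists>w\<in>span (insert b K). \<phi> (fst p) (snd p + w)) \<longleftrightarrow>
        (\<exists>t. \<exists>w\<in>span K. \<phi> (fst (p + t *\<^sub>R (0, b))) (snd (p + t *\<^sub>R (0, b)) + w))" for p
    proof
      assume "\<exists>w\<in>span (insert b K). \<phi> (fst p) (snd p + w)"
      then obtain w t where w: "\<phi> (fst p) (snd p + w)" "w - t *\<^sub>R b \<in> span K"
        by (auto simp: span_insert)
      have "\<phi> (fst p) (snd p + t *\<^sub>R b + (w - t *\<^sub>R b))" using w(1) by simp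
      with w(2) show "\<exists>t. \<exists>w\<in>span K. \<phi> (fst (p + t *\<^sub>R (0, b))) (snd (p + t *\<^sub>R (0, b)) + w)"
        by (intro exI[of _ t] bexI[of _ "w - t *\<^sub>R b"]) simp_all
    next
      assume "\<exists>t. \<exists>w\<in>span K. \<phi> (fst (p + t *\<^sub>R (0, b))) (snd (p + t *\<^sub>R (0, b)) + w)"
      then obtain t w where w: "w \<in> span K" "\<phi> (fst p) (snd p + t *\<^sub>R b + w)" by auto
      have "w \<in> span (insert b K)" using w(1) span_mono[of K "insert b K"] by blast
      then have "t *\<^sub>R b + w \<in> span (insert b K)"
        by (intro span_add span_scale) (auto intro: span_base)
      with w(2) show "\<exists>w\<in>span (insert b K). \<phi> (fst p) (snd p + w)"
        by (auto simp: add.assoc)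
    qed
    then show ?case using semialgebraic_ex_direction[OF insert.IH, of "(0, b)"] by simp
  qed
  from this[OF finite_Basis] have "semialgebraic (\<lambda>p. \<exists>w. \<phi> (fst p) (snd p + w))"
    by simp
  moreover have "polynomial_function (\<lambda>e::'a. (e, 0::'b))"
    by (intro polynomial_function_bounded_linear bounded_linear_Pair bounded_linear_ident bounded_linear_zero)
  ultimately show ?thesis using semialgebraic_compose by fastforce
qed

lemma semialgebraic_all:
  fixes \<phi> :: "'a::real_normed_vector \<Rightarrow> 'b::euclidean_space \<Rightarrow> bool"
  assumes "semialgebraic (\<lambda>p. \<phi> (fst p) (snd p))"
  shows "semialgebraic (\<lambda>e. \<forall>x. \<phi> e x)"
proof -
  have "semialgebraic (\<lambda>e. \<not> (\<exists>x. \<not> \<phi> e x))"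
    by (intro semialgebraic_not semialgebraic_ex assms)
  then show ?thesis by simp
qed

lemma poly_sign_eventually_constant:
  fixes f :: "real poly" and c :: real
  shows "\<exists>\<sigma>. \<forall>\<^sub>F t in at_right c. sgn (poly f t) = \<sigma>"
proof (cases "f = 0")
  case False
  define Z where "Z = {t. poly f t = 0} \<inter> {c<..}"
  have "finite Z" using poly_roots_finite[OF False] by (simp add: Z_def)
  then obtain d where d: "c < d" "\<forall>z\<in>Z. d < z"
    using finite_sets_gap[of "{c}" Z] by (auto simp: Z_def)
  have "sgn (poly f t) = sgn (poly f d)" if "c < t" "t < d" for t
  proof (rule ccontr)
    assume "sgn (poly f t) \<noteq> sgn (poly f d)"
    from sign_change_root[OF this] obtain z
      where z: "t \<le> z \<and> z \<le> d \<or> d \<le> z \<and> z \<le> t" "poly f z = 0" by blast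
    then have "z \<in> Z" "z \<le> d" using that by (auto simp: Z_def)
    with d(2) show False by force
  qed
  then show ?thesis
    using eventually_at_right_real[OF d(1)]
    by (intro exI[of _ "sgn (poly f d)"]) (auto elim: eventually_mono)
qed auto

text \<open>
  In one variable every polynomial has constant sign close to a point on either side of it, and so a
  semialgebraic predicate is constant close to the point on that side. The factor \<open>v\<close> selects the side.
\<close>

lemma semialgebraic_eventually_constant_right:
  fixes \<phi> :: "real \<Rightarrow> bool" and c v :: real
  assumes "semialgebraic \<phi>"
  shows "\<exists>b. \<forall>\<^sub>F t in at_right 0. \<phi> (c + t * v) = b"
proof -
  obtain Q where Q: "finite Q" "\<forall>q\<in>Q. real_polynomial_function q"
    "\<And>e e'. same_signs Q e e' \<Longrightarrow> \<phi> e = \<phi> e'"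
    using assms unfolding semialgebraic_def by blast
  have "\<exists>\<sigma>. \<forall>\<^sub>F t in at_right 0. sgn (q (c + t * v)) = \<sigma>" if "q \<in> Q" for q
  proof -
    have "real_polynomial_function q" using Q(2) that by blast
    from polynomial_along_line[OF this, of v]
    obtain p :: "real \<Rightarrow> real poly" where "\<forall>e t. poly (p e) t = q (e + t *\<^sub>R v)" by blast
    then show ?thesis using poly_sign_eventually_constant[of "p c" 0] by simp
  qed
  then obtain \<sigma> where "\<forall>q\<in>Q. \<forall>\<^sub>F t in at_right 0. sgn (q (c + t * v)) = \<sigma> q" by metis
  then have ev: "\<forall>\<^sub>F t in at_right 0. \<forall>q\<in>Q. sgn (q (c + t * v)) = \<sigma> q"
    using Q(1) by (intro eventually_ball_finite)
  then obtain s where "\<forall>q\<in>Q. sgn (q (c + s * v)) = \<sigma> q"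
    using eventually_happens'[of "at_right (0::real)"] by (auto simp: trivial_limit_at_right_real)
  with ev have "\<forall>\<^sub>F t in at_right 0. \<phi> (c + t * v) = \<phi> (c + s * v)"
    by (auto elim!: eventually_mono intro!: Q(3) simp: same_signs_def)
  then show ?thesis by blast
qed

section \<open>The optimal partition depends semialgebraically on the parameter\<close>

lemma real_polynomial_function_nth:
  fixes f :: "'a::real_normed_vector \<Rightarrow> real^'n"
  assumes "polynomial_function f"
  shows "real_polynomial_function (\<lambda>e. f e $ i)"
  using assms bounded_linear_vec_nth[of i] unfolding polynomial_function_def o_def by blast

lemma polynomial_function_fst:
  assumes "polynomial_function f"
  shows "polynomial_function (\<lambda>e. fst (f e))"
  using polynomial_function_compose[OF assms polynomial_function_bounded_linear[OF bounded_linear_fst]]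
  by (simp add: o_def)

lemma polynomial_function_snd:
  assumes "polynomial_function f"
  shows "polynomial_function (\<lambda>e. snd (f e))"
  using polynomial_function_compose[OF assms polynomial_function_bounded_linear[OF bounded_linear_snd]]
  by (simp add: o_def)

lemma polynomial_function_fst_arg:
  assumes "polynomial_function f"
  shows "polynomial_function (\<lambda>p. f (fst p))"
  using polynomial_function_compose[OF polynomial_function_fst[OF polynomial_function_id] assms]
  by (simp add: o_def)

lemma real_polynomial_function_fst_arg:
  "real_polynomial_function f \<Longrightarrow> real_polynomial_function (\<lambda>p. f (fst p))"
  using polynomial_function_fst_arg[of f] by (simp add: real_polynomial_function_eq)

lemma polynomial_function_vec:
  fixes f :: "'a::real_normed_vector \<Rightarrow> real^'n"
  assumes "\<And>i. real_polynomial_function (\<lambda>e. f e $ i)"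
  shows "polynomial_function f"
  unfolding polynomial_function_iff_Basis_inner
  using assms by (auto simp: Basis_vec_def inner_axis)

lemma real_polynomial_function_inner:
  fixes f g :: "'a::real_normed_vector \<Rightarrow> real^'n"
  assumes "polynomial_function f" "polynomial_function g"
  shows "real_polynomial_function (\<lambda>e. f e \<bullet> g e)"
  unfolding inner_vec_def inner_real_def
  by (intro real_polynomial_function_sum real_polynomial_function.intros(4)
      real_polynomial_function_nth assms) simp

lemma polynomial_function_matrix_vector:
  fixes f :: "'a::real_normed_vector \<Rightarrow> real^'n" and A :: "real^'n^'m"
  assumes "polynomial_function f"
  shows "polynomial_function (\<lambda>e. A *v f e)"
  using polynomial_function_compose[OF assms polynomial_function_bounded_linear,
      OF matrix_vector_mul_bounded_linear[of A]] by (simp add: o_def)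

lemma polynomial_function_obj:
  assumes "real_polynomial_function f"
  shows "polynomial_function (\<lambda>e. obj P (f e))"
  unfolding obj_def using assms
  by (intro polynomial_function_add polynomial_function_mult polynomial_function_const)
    (simp add: real_polynomial_function_eq)

lemmas poly_fun = real_polynomial_function_nth real_polynomial_function_inner
  polynomial_function_fst polynomial_function_snd polynomial_function_matrix_vector
  polynomial_function_obj polynomial_function_add polynomial_function_id polynomial_function_const

lemma real_polynomial_function_tail_sum:
  assumes "polynomial_function f"
  shows "real_polynomial_function (\<lambda>e. \<Sum>j\<in>block P i - {lead P i}. (f e $ j)\<^sup>2)"
  by (intro real_polynomial_function_sum real_polynomial_function_power
      real_polynomial_function_nth assms) simp

lemma sqrt_le_iff_square:
  assumes "0 \<le> (u::real)"
  shows "sqrt u \<le> a \<longleftrightarrow> 0 \<le> a \<and> u \<le> a\<^sup>2" "a = sqrt u \<longleftrightarrow> 0 \<le> a \<and> u = a\<^sup>2"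
proof -
  show "sqrt u \<le> a \<longleftrightarrow> 0 \<le> a \<and> u \<le> a\<^sup>2"
    using real_sqrt_ge_zero[OF assms] real_le_lsqrt[of a u] sqrt_le_D[of u a] by linarith
  show "a = sqrt u \<longleftrightarrow> 0 \<le> a \<and> u = a\<^sup>2"
    using real_sqrt_ge_zero[OF assms] assms by auto
qed

lemma semialgebraic_blk_cone:
  assumes f: "polynomial_function f"
  shows "semialgebraic (\<lambda>e. blk_cone P i (f e))"
proof -
  have "blk_cone P i x \<longleftrightarrow>
      0 \<le> x $ lead P i \<and> (\<Sum>j\<in>block P i - {lead P i}. (x $ j)\<^sup>2) \<le> (x $ lead P i)\<^sup>2" for x
    unfolding blk_cone_def tail_norm_def L2_set_def
    by (intro sqrt_le_iff_square(1) sum_nonneg) simp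
  then show ?thesis
    by (simp only:) (intro semialgebraic_conj semialgebraic_le real_polynomial_function_tail_sum
      real_polynomial_function_power real_polynomial_function_nth real_polynomial_function.intros(2) f)
qed

lemma semialgebraic_blk_bd:
  assumes f: "polynomial_function f"
  shows "semialgebraic (\<lambda>e. blk_bd P i (f e))"
proof -
  have "blk_bd P i x \<longleftrightarrow>
      0 \<le> x $ lead P i \<and> (\<Sum>j\<in>block P i - {lead P i}. (x $ j)\<^sup>2) = (x $ lead P i)\<^sup>2" for x
    unfolding blk_bd_def tail_norm_def L2_set_def
    by (intro sqrt_le_iff_square(2) sum_nonneg) simp
  then show ?thesis
    by (simp only:) (intro semialgebraic_conj semialgebraic_le semialgebraic_eq real_polynomial_function_tail_sum
      real_polynomial_function_power real_polynomial_function_nth real_polynomial_function.intros(2) f)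
qed

lemma semialgebraic_blk_int:
  assumes f: "polynomial_function f"
  shows "semialgebraic (\<lambda>e. blk_int P i (f e))"
proof -
  have "blk_int P i x \<longleftrightarrow> blk_cone P i x \<and> \<not> blk_bd P i x" for x
    by (auto simp: blk_int_def blk_cone_def blk_bd_def)
  then show ?thesis
    by (simp only:) (intro semialgebraic_conj semialgebraic_not semialgebraic_blk_cone
      semialgebraic_blk_bd f)
qed

lemma semialgebraic_blk_zero:
  fixes P :: "('m::finite, 'n::finite, 'p) psoco"
  assumes f: "polynomial_function f"
  shows "semialgebraic (\<lambda>e. blk_zero P i (f e))"
  unfolding blk_zero_def
  by (intro semialgebraic_Ball semialgebraic_eq real_polynomial_function_nth
      real_polynomial_function.intros(2) f) simp

lemma semialgebraic_soc:
  fixes P :: "('m::finite, 'n::finite, 'p::finite) psoco"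
  assumes f: "polynomial_function f"
  shows "semialgebraic (\<lambda>e. f e \<in> soc P)"
proof -
  have "semialgebraic (\<lambda>e. \<forall>i\<in>UNIV. blk_cone P i (f e))"
    by (intro semialgebraic_Ball semialgebraic_blk_cone f) simp
  then show ?thesis by (simp add: soc_def)
qed

lemma semialgebraic_primal_feas:
  fixes P :: "('m::finite, 'n::finite, 'p::finite) psoco"
  assumes f: "polynomial_function f"
  shows "semialgebraic (\<lambda>e. f e \<in> primal_feas P)"
  unfolding primal_feas_def mem_Collect_eq
  by (intro semialgebraic_conj semialgebraic_soc semialgebraic_vec_eq real_polynomial_function_nth
      polynomial_function_matrix_vector polynomial_function_const f)

text \<open>
  The optimal value as a greatest lower bound, with quantifiers over real vectors and numbers only; an
  infinite value satisfies neither side.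
\<close>

lemma opt_val_eq_iff:
  "opt_val P \<epsilon> = ereal r \<longleftrightarrow> (\<forall>x. x \<in> primal_feas P \<longrightarrow> r \<le> obj P \<epsilon> \<bullet> x) \<and>
     (\<forall>r'. (\<forall>x. x \<in> primal_feas P \<longrightarrow> r' \<le> obj P \<epsilon> \<bullet> x) \<longrightarrow> r' \<le> r)"
proof -
  have lower: "ereal u \<le> opt_val P \<epsilon> \<longleftrightarrow> (\<forall>x. x \<in> primal_feas P \<longrightarrow> u \<le> obj P \<epsilon> \<bullet> x)" for u
    unfolding opt_val_def le_INF_iff by auto
  show ?thesis
    unfolding lower[symmetric]
  proof
    assume r: "ereal r \<le> opt_val P \<epsilon> \<and> (\<forall>r'. ereal r' \<le> opt_val P \<epsilon> \<longrightarrow> r' \<le> r)"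
    have "opt_val P \<epsilon> \<le> ereal r"
    proof (rule ccontr)
      assume "\<not> ?thesis"
      then have "ereal r < opt_val P \<epsilon>" by simp
      then obtain u where "ereal r < ereal u" "ereal u < opt_val P \<epsilon>"
        using ereal_dense2 by blast
      with r show False by (metis ereal_less_eq(3) less_imp_le linorder_not_le less_ereal.simps(1))
    qed
    with r show "opt_val P \<epsilon> = ereal r" by (simp add: antisym)
  qed auto
qed

lemma semialgebraic_opt_val:
  fixes P :: "('m::finite, 'n::finite, 'p::finite) psoco"
  assumes f: "real_polynomial_function f" and r: "real_polynomial_function r"
  shows "semialgebraic (\<lambda>e. opt_val P (f e) = ereal (r e))"
proof -
  note f1 = real_polynomial_function_fst_arg[OF f]
  note f2 = real_polynomial_function_fst_arg[OF f1]
  note r1 = real_polynomial_function_fst_arg[OF r]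
  have snd: "real_polynomial_function (\<lambda>p. snd p)" "real_polynomial_function (\<lambda>p. snd (fst p))"
    by (simp_all add: real_polynomial_function_eq polynomial_function_snd polynomial_function_fst)
  show ?thesis
    unfolding opt_val_eq_iff
    by (intro semialgebraic_conj semialgebraic_all semialgebraic_imp semialgebraic_primal_feas
        semialgebraic_le real_polynomial_function_inner polynomial_function_obj
        polynomial_function_snd polynomial_function_id f1 f2 r1 snd)
qed

lemma semialgebraic_primal_opt:
  fixes P :: "('m::finite, 'n::finite, 'p::finite) psoco"
  assumes f: "real_polynomial_function f" and x: "polynomial_function x"
  shows "semialgebraic (\<lambda>e. x e \<in> primal_opt P (f e))"
  unfolding primal_opt_def mem_Collect_eq eq_commute[of "ereal _"]
  by (intro semialgebraic_conj semialgebraic_primal_feas semialgebraic_opt_val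
      real_polynomial_function_inner polynomial_function_obj f x)

lemma semialgebraic_dual_opt:
  fixes P :: "('m::finite, 'n::finite, 'p::finite) psoco"
  assumes f: "real_polynomial_function f" and z: "polynomial_function z"
  shows "semialgebraic (\<lambda>e. z e \<in> dual_opt P (f e))"
  unfolding dual_opt_def dual_feas_def mem_Collect_eq case_prod_unfold prod.collapse eq_commute[of "ereal _"]
  by (intro semialgebraic_conj semialgebraic_soc semialgebraic_opt_val semialgebraic_vec_eq
      real_polynomial_function_nth polynomial_function_add polynomial_function_matrix_vector
      real_polynomial_function_inner polynomial_function_obj
      polynomial_function_fst polynomial_function_snd polynomial_function_const f z)

lemma semialgebraic_ex_primal_opt:
  fixes P :: "('m::finite, 'n::finite, 'p::finite) psoco"
  assumes "real_polynomial_function f" "semialgebraic (\<lambda>p. \<phi> (fst p) (snd p))"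
  shows "semialgebraic (\<lambda>e. \<exists>x\<in>primal_opt P (f e). \<phi> e x)"
  unfolding Bex_def using assms
  by (intro semialgebraic_ex semialgebraic_conj semialgebraic_primal_opt
      real_polynomial_function_fst_arg polynomial_function_snd polynomial_function_id)

lemma semialgebraic_ex_dual_opt:
  fixes P :: "('m::finite, 'n::finite, 'p::finite) psoco"
  assumes "real_polynomial_function f" "semialgebraic (\<lambda>p. \<phi> (fst p) (snd p))"
  shows "semialgebraic (\<lambda>e. \<exists>z\<in>dual_opt P (f e). \<phi> e z)"
  unfolding Bex_def using assms
  by (intro semialgebraic_ex semialgebraic_conj semialgebraic_dual_opt
      real_polynomial_function_fst_arg polynomial_function_snd polynomial_function_id)

lemma semialgebraic_all_primal_opt:
  fixes P :: "('m::finite, 'n::finite, 'p::finite) psoco"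
  assumes "real_polynomial_function f" "semialgebraic (\<lambda>p. \<phi> (fst p) (snd p))"
  shows "semialgebraic (\<lambda>e. \<forall>x\<in>primal_opt P (f e). \<phi> e x)"
  unfolding Ball_def using assms
  by (intro semialgebraic_all semialgebraic_imp semialgebraic_primal_opt
      real_polynomial_function_fst_arg polynomial_function_snd polynomial_function_id)

lemma semialgebraic_all_dual_opt:
  fixes P :: "('m::finite, 'n::finite, 'p::finite) psoco"
  assumes "real_polynomial_function f" "semialgebraic (\<lambda>p. \<phi> (fst p) (snd p))"
  shows "semialgebraic (\<lambda>e. \<forall>z\<in>dual_opt P (f e). \<phi> e z)"
  unfolding Ball_def using assms
  by (intro semialgebraic_all semialgebraic_imp semialgebraic_dual_opt
      real_polynomial_function_fst_arg polynomial_function_snd polynomial_function_id)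

lemma semialgebraic_partition:
  fixes P :: "('m::finite, 'n::finite, 'p::finite) psoco"
  shows "semialgebraic (\<lambda>\<epsilon>. i \<in> part_B P \<epsilon>)" "semialgebraic (\<lambda>\<epsilon>. i \<in> part_N P \<epsilon>)"
    "semialgebraic (\<lambda>\<epsilon>. i \<in> part_R P \<epsilon>)" "semialgebraic (\<lambda>\<epsilon>. i \<in> part_T P \<epsilon>)"
    "semialgebraic (\<lambda>\<epsilon>. i \<in> part_T1 P \<epsilon>)" "semialgebraic (\<lambda>\<epsilon>. i \<in> part_T2 P \<epsilon>)"
    "semialgebraic (\<lambda>\<epsilon>. i \<in> part_T3 P \<epsilon>)"
proof -
  have id: "real_polynomial_function (\<lambda>\<epsilon>::real. \<epsilon>)"
    and fst: "real_polynomial_function (\<lambda>p::real \<times> (real^'n). fst p)"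
    by (simp_all add: real_polynomial_function_eq polynomial_function_fst)
  note quant = semialgebraic_ex_primal_opt semialgebraic_ex_dual_opt
    semialgebraic_all_primal_opt semialgebraic_all_dual_opt id fst
  note blocks = semialgebraic_conj semialgebraic_not semialgebraic_blk_int semialgebraic_blk_bd
    semialgebraic_blk_zero polynomial_function_fst polynomial_function_snd polynomial_function_id
  show B: "semialgebraic (\<lambda>\<epsilon>. i \<in> part_B P \<epsilon>)"
    unfolding part_B_def mem_Collect_eq by (intro quant blocks)
  show N: "semialgebraic (\<lambda>\<epsilon>. i \<in> part_N P \<epsilon>)"
    unfolding part_N_def mem_Collect_eq case_prod_unfold by (intro quant blocks)
  show R: "semialgebraic (\<lambda>\<epsilon>. i \<in> part_R P \<epsilon>)"
    unfolding part_R_def mem_Collect_eq case_prod_unfold by (intro quant blocks)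
  have "semialgebraic (\<lambda>\<epsilon>. \<not> i \<in> part_B P \<epsilon> \<and> \<not> i \<in> part_N P \<epsilon> \<and> \<not> i \<in> part_R P \<epsilon>)"
    by (intro semialgebraic_conj semialgebraic_not B N R)
  then show T: "semialgebraic (\<lambda>\<epsilon>. i \<in> part_T P \<epsilon>)"
    by (simp add: part_T_def)
  show "semialgebraic (\<lambda>\<epsilon>. i \<in> part_T1 P \<epsilon>)"
    unfolding part_T1_def mem_Collect_eq case_prod_unfold by (intro semialgebraic_conj T quant blocks)
  show "semialgebraic (\<lambda>\<epsilon>. i \<in> part_T2 P \<epsilon>)"
    unfolding part_T2_def mem_Collect_eq case_prod_unfold by (intro semialgebraic_conj T quant blocks)
  show "semialgebraic (\<lambda>\<epsilon>. i \<in> part_T3 P \<epsilon>)"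
    unfolding part_T3_def mem_Collect_eq case_prod_unfold by (intro semialgebraic_conj T quant blocks)
qed

lemma semialgebraic_set_eq:
  fixes X :: "'a::real_normed_vector \<Rightarrow> 'p::finite set"
  assumes "\<And>i. semialgebraic (\<lambda>e. i \<in> X e)"
  shows "semialgebraic (\<lambda>e. X e = Y)"
proof -
  have "semialgebraic (\<lambda>e. \<forall>i\<in>UNIV. (i \<in> X e) = (i \<in> Y))"
    by (intro semialgebraic_Ball semialgebraic_iff_const assms) simp
  then show ?thesis by (simp add: set_eq_iff)
qed

text \<open>
  Optimality, and with it each of the index sets, is expressed by polynomial relations and
  quantifiers over vectors.
\<close>

theorem semialgebraic_same_partition:
  fixes P :: "('m::finite, 'n::finite, 'p::finite) psoco"
  shows "semialgebraic (\<lambda>\<epsilon>. \<epsilon> \<in> same_partition_set P \<epsilon>0)"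
proof -
  have id: "real_polynomial_function (\<lambda>\<epsilon>::real. \<epsilon>)"
    by (simp add: real_polynomial_function_eq)
  have "semialgebraic (\<lambda>\<epsilon>. (\<exists>x\<in>primal_opt P \<epsilon>. True) \<and> (\<exists>z\<in>dual_opt P \<epsilon>. True) \<and>
      part_B P \<epsilon> = part_B P \<epsilon>0 \<and> part_N P \<epsilon> = part_N P \<epsilon>0 \<and> part_R P \<epsilon> = part_R P \<epsilon>0 \<and>
      part_T P \<epsilon> = part_T P \<epsilon>0 \<and> part_T1 P \<epsilon> = part_T1 P \<epsilon>0 \<and> part_T2 P \<epsilon> = part_T2 P \<epsilon>0 \<and>
      part_T3 P \<epsilon> = part_T3 P \<epsilon>0)"
    by (intro semialgebraic_conj semialgebraic_set_eq semialgebraic_partition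
        semialgebraic_ex_primal_opt semialgebraic_ex_dual_opt semialgebraic_const id)
  moreover have "(\<epsilon> \<in> same_partition_set P \<epsilon>0) = ((\<exists>x\<in>primal_opt P \<epsilon>. True) \<and> (\<exists>z\<in>dual_opt P \<epsilon>. True) \<and>
      part_B P \<epsilon> = part_B P \<epsilon>0 \<and> part_N P \<epsilon> = part_N P \<epsilon>0 \<and> part_R P \<epsilon> = part_R P \<epsilon>0 \<and>
      part_T P \<epsilon> = part_T P \<epsilon>0 \<and> part_T1 P \<epsilon> = part_T1 P \<epsilon>0 \<and> part_T2 P \<epsilon> = part_T2 P \<epsilon>0 \<and>
      part_T3 P \<epsilon> = part_T3 P \<epsilon>0)" for \<epsilon>
    by (auto simp: same_partition_set_def opt_partition_def)
  ultimately show ?thesis by (simp only:)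
qed

section \<open>The perturbed system near the given solution\<close>

lemma inner_by_blocks:
  fixes P :: "('m::finite, 'n::finite, 'p::finite) psoco" and x s :: "real^'n"
  shows "x \<bullet> s = (\<Sum>i\<in>UNIV. \<Sum>j\<in>block P i. x $ j * s $ j)"
  using sum.group[of "UNIV :: 'n set" "UNIV :: 'p set" "blk P" "\<lambda>j. x $ j * s $ j"]
  by (simp add: block_def inner_vec_def)

lemma block_sum_split:
  fixes h :: "'n::finite \<Rightarrow> real"
  assumes "block_structure (P :: ('m::finite, 'n, 'p) psoco)"
  shows "(\<Sum>j\<in>block P i. h j) = h (lead P i) + (\<Sum>j\<in>block P i - {lead P i}. h j)"
  using assms by (subst sum.remove[of _ "lead P i"]) (auto simp: block_def block_structure_def)

lemma cone_tail_bound: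
  assumes "blk_cone P i x"
  shows "0 \<le> x $ lead P i" "(\<Sum>j\<in>block P i - {lead P i}. (x $ j)\<^sup>2) \<le> (x $ lead P i)\<^sup>2"
  using assms sqrt_le_iff_square(1)[OF sum_nonneg[of _ "\<lambda>j. (x $ j)\<^sup>2"]]
  unfolding blk_cone_def tail_norm_def L2_set_def by auto

lemma cone_inner_nonneg:
  assumes "block_structure P" "blk_cone P i x" "blk_cone P i s"
  shows "0 \<le> (\<Sum>j\<in>block P i. x $ j * s $ j)"
proof -
  let ?T = "block P i - {lead P i}"
  have "\<bar>\<Sum>j\<in>?T. x $ j * s $ j\<bar> \<le> tail_norm P i x * tail_norm P i s"
    unfolding tail_norm_def
    by (rule order_trans[OF sum_abs]) (use L2_set_mult_ineq in \<open>simp add: abs_mult\<close>)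
  also have "\<dots> \<le> x $ lead P i * s $ lead P i"
    using assms(2,3) cone_tail_bound(1)[OF assms(2)]
    by (intro mult_mono) (auto simp: blk_cone_def tail_norm_def)
  finally show ?thesis using block_sum_split[OF assms(1), of "\<lambda>j. x $ j * s $ j" i] by linarith
qed

text \<open>
  Each block contributes a nonnegative amount to \<open>x \<bullet> s\<close>, so each contribution is zero. With the
  leading entries \<open>a\<close> of \<open>x\<close> and \<open>b\<close> of \<open>s\<close> in the block, the tails then have inner product \<open>- (a * b)\<close>
  and norms at most \<open>a\<close> and \<open>b\<close>. Expanding the squares bounds the sum of all
  \<open>(a * s $ j + b * x $ j)\<^sup>2\<close> by \<open>a\<^sup>2 * b\<^sup>2 + b\<^sup>2 * a\<^sup>2 - 2 * a\<^sup>2 * b\<^sup>2 = 0\<close>.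
\<close>

lemma jordan_prod_eq_0:
  fixes P :: "('m::finite, 'n::finite, 'p::finite) psoco"
  assumes P: "block_structure P" and x: "x \<in> soc P" and s: "s \<in> soc P" and xs: "x \<bullet> s = 0"
  shows "jordan_prod P x s = 0"
proof -
  have cone: "blk_cone P i x" "blk_cone P i s" for i using x s by (auto simp: soc_def)
  have zero: "(\<Sum>j\<in>block P i. x $ j * s $ j) = 0" for i
    using xs cone_inner_nonneg[OF P cone] unfolding inner_by_blocks[of x s P]
    by (subst (asm) sum_nonneg_eq_0_iff) auto
  have tail: "x $ lead P i * s $ j + s $ lead P i * x $ j = 0" if j: "j \<in> block P i" "j \<noteq> lead P i" for i j
  proof -
    let ?T = "block P i - {lead P i}"
    define a b where "a = x $ lead P i" and "b = s $ lead P i"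
    have xs: "(\<Sum>j\<in>?T. x $ j * s $ j) = - (a * b)"
      using zero[of i] block_sum_split[OF P, of "\<lambda>j. x $ j * s $ j" i] by (simp add: a_def b_def)
    have "(\<Sum>j\<in>?T. (a * s $ j + b * x $ j)\<^sup>2) =
        a\<^sup>2 * (\<Sum>j\<in>?T. (s $ j)\<^sup>2) + b\<^sup>2 * (\<Sum>j\<in>?T. (x $ j)\<^sup>2) + 2 * (a * b) * (\<Sum>j\<in>?T. x $ j * s $ j)"
      unfolding sum_distrib_left sum.distrib[symmetric]
      by (rule sum.cong) (auto simp: power2_eq_square algebra_simps)
    also have "\<dots> \<le> a\<^sup>2 * b\<^sup>2 + b\<^sup>2 * a\<^sup>2 + 2 * (a * b) * (\<Sum>j\<in>?T. x $ j * s $ j)"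
      using cone_tail_bound(2)[OF cone(1)[of i]] cone_tail_bound(2)[OF cone(2)[of i]]
      by (intro add_mono mult_left_mono order_refl) (simp_all add: a_def b_def)
    also have "\<dots> = 0" unfolding xs by (simp add: power2_eq_square algebra_simps)
    finally have "(\<Sum>j\<in>?T. (a * s $ j + b * x $ j)\<^sup>2) \<le> 0" .
    then have "(\<Sum>j\<in>?T. (a * s $ j + b * x $ j)\<^sup>2) = 0" by (simp add: antisym sum_nonneg)
    then have "\<forall>j\<in>?T. (a * s $ j + b * x $ j)\<^sup>2 = 0" by (subst (asm) sum_nonneg_eq_0_iff) auto
    then show ?thesis using j by (simp add: a_def b_def)
  qed
  show ?thesis
    unfolding vec_eq_iff
  proof
    fix j
    have "j \<in> block P (blk P j)" by (simp add: block_def)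
    then show "jordan_prod P x s $ j = 0 $ j"
      using zero tail by (simp add: jordan_prod_def Let_def)
  qed
qed

lemma optimal_complementary:
  fixes P :: "('m::finite, 'n::finite, 'p::finite) psoco"
  assumes x: "x \<in> primal_opt P \<epsilon>" and ys: "(y, s) \<in> dual_opt P \<epsilon>"
  shows "x \<bullet> s = 0"
proof -
  have "ereal (obj P \<epsilon> \<bullet> x) = ereal (rhs P \<bullet> y)"
    using x ys by (auto simp: primal_opt_def dual_opt_def)
  then have "obj P \<epsilon> \<bullet> x = rhs P \<bullet> y" by simp
  moreover have "Amat P *v x = rhs P" "transpose (Amat P) *v y + s = obj P \<epsilon>"
    using x ys by (auto simp: primal_opt_def primal_feas_def dual_opt_def dual_feas_def)
  moreover have "(transpose (Amat P) *v y) \<bullet> x = y \<bullet> (Amat P *v x)"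
    by (metis dot_lmul_matrix inner_commute transpose_matrix_vector)
  ultimately have "(obj P \<epsilon> - transpose (Amat P) *v y) \<bullet> x = 0"
    unfolding inner_diff_left by (simp add: inner_commute)
  moreover have "obj P \<epsilon> - transpose (Amat P) *v y = s"
    using \<open>transpose (Amat P) *v y + s = obj P \<epsilon>\<close> by (simp add: algebra_simps)
  ultimately show ?thesis by (simp add: inner_commute)
qed

text \<open>
  As \<open>dcost P \<noteq> 0\<close>, the dual equation determines the parameter, by projection on \<open>dcost P\<close>. The
  perturbation set is therefore the continuous image of the solutions in a closed ball.
\<close>

definition parameter_of :: "('m::finite, 'n::finite, 'p) psoco \<Rightarrow> (real^'n) \<times> (real^'m) \<times> (real^'n) \<Rightarrow> real" where
  "parameter_of P z = (transpose (Amat P) *v fst (snd z) + snd (snd z) - cost P) \<bullet> dcost P / (dcost P \<bullet> dcost P)"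

definition pert_solutions ::
  "('m::finite, 'n::finite, 'p) psoco \<Rightarrow> ((real^'n) \<times> (real^'m) \<times> (real^'n)) set" where
  "pert_solutions P = {z. Amat P *v fst z = rhs P \<and>
     transpose (Amat P) *v fst (snd z) + snd (snd z) = obj P (parameter_of P z) \<and>
     jordan_prod P (fst z) (snd (snd z)) = 0}"

lemma parameter_of_unique:
  fixes P :: "('m::finite, 'n::finite, 'p) psoco"
  assumes "dcost P \<noteq> 0" "transpose (Amat P) *v y + s = obj P \<epsilon>"
  shows "parameter_of P (x, y, s) = \<epsilon>"
proof -
  have "transpose (Amat P) *v y + s - cost P = \<epsilon> *\<^sub>R dcost P"
    using assms(2) by (simp add: obj_def)
  then show ?thesis using assms(1) by (simp add: parameter_of_def)
qed

lemma pert_set_eq_image: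
  fixes P :: "('m::finite, 'n::finite, 'p) psoco"
  assumes "dcost P \<noteq> 0" "0 \<le> \<delta>"
  shows "pert_set P x0 y0 s0 \<delta> = parameter_of P ` (cball (x0, y0, s0) \<delta> \<inter> pert_solutions P)"
proof -
  have near: "(norm (x - x0, y - y0, s - s0))\<^sup>2 \<le> \<delta>\<^sup>2 \<longleftrightarrow> (x, y, s) \<in> cball (x0, y0, s0) \<delta>" for x y s
    using assms(2) by (simp add: mem_cball dist_norm norm_minus_commute flip: abs_le_square_iff)
      (metis diff_Pair norm_minus_commute)
  show ?thesis
  proof (intro set_eqI iffI)
    fix \<epsilon> assume "\<epsilon> \<in> pert_set P x0 y0 s0 \<delta>"
    then obtain x y s where z: "Amat P *v x = rhs P" "transpose (Amat P) *v y + s = obj P \<epsilon>"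
        "jordan_prod P x s = 0" "(x, y, s) \<in> cball (x0, y0, s0) \<delta>"
      unfolding pert_set_def near by blast
    then show "\<epsilon> \<in> parameter_of P ` (cball (x0, y0, s0) \<delta> \<inter> pert_solutions P)"
      using parameter_of_unique[OF assms(1) z(2), of x]
      by (intro image_eqI[of _ _ "(x, y, s)"]) (simp_all add: pert_solutions_def)
  next
    fix \<epsilon> assume "\<epsilon> \<in> parameter_of P ` (cball (x0, y0, s0) \<delta> \<inter> pert_solutions P)"
    then obtain x y s where "(x, y, s) \<in> cball (x0, y0, s0) \<delta>" "(x, y, s) \<in> pert_solutions P"
        "\<epsilon> = parameter_of P (x, y, s)" by auto
    then show "\<epsilon> \<in> pert_set P x0 y0 s0 \<delta>"
      unfolding pert_set_def near by (auto simp: pert_solutions_def)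
  qed
qed

lemma real_polynomial_function_parameter_of:
  fixes P :: "('m::finite, 'n::finite, 'p) psoco"
  shows "real_polynomial_function (parameter_of P)"
  unfolding parameter_of_def
  by (intro real_polynomial_function_divide real_polynomial_function_inner polynomial_function_diff
      poly_fun)

lemma continuous_parameter_of: "continuous_on S (parameter_of P)"
  using real_polynomial_function_parameter_of
  by (intro continuous_on_polymonial_function) (simp add: real_polynomial_function_eq)

lemma polynomial_function_jordan_prod:
  fixes P :: "('m::finite, 'n::finite, 'p) psoco"
  assumes f: "polynomial_function f" and g: "polynomial_function g"
  shows "polynomial_function (\<lambda>e. jordan_prod P (f e) (g e))"
proof (rule polynomial_function_vec)
  fix j
  show "real_polynomial_function (\<lambda>e. jordan_prod P (f e) (g e) $ j)"
  proof (cases "j = lead P (blk P j)")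
    case True
    then have "jordan_prod P (f e) (g e) $ j = (\<Sum>k\<in>block P (blk P j). f e $ k * g e $ k)" for e
      by (simp add: jordan_prod_def Let_def)
    then show ?thesis
      by (simp only:) (intro real_polynomial_function_sum real_polynomial_function.intros(4)
        real_polynomial_function_nth f g, simp)
  next
    case False
    then have "jordan_prod P (f e) (g e) $ j =
        f e $ lead P (blk P j) * g e $ j + g e $ lead P (blk P j) * f e $ j" for e
      by (simp add: jordan_prod_def Let_def)
    then show ?thesis
      by (simp only:) (intro real_polynomial_function.intros(3,4) real_polynomial_function_nth f g)
  qed
qed

lemma closed_pert_solutions:
  fixes P :: "('m::finite, 'n::finite, 'p) psoco"
  shows "closed (pert_solutions P)"
  unfolding pert_solutions_def
  by (intro closed_Collect_conj closed_Collect_eq continuous_on_polymonial_function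
      polynomial_function_jordan_prod poly_fun real_polynomial_function_parameter_of)

lemma compact_pert_set:
  fixes P :: "('m::finite, 'n::finite, 'p) psoco"
  assumes "dcost P \<noteq> 0" "0 \<le> \<delta>"
  shows "compact (pert_set P x0 y0 s0 \<delta>)"
  unfolding pert_set_eq_image[OF assms]
  by (intro compact_continuous_image continuous_parameter_of compact_Int_closed compact_cball
      closed_pert_solutions)

lemma pert_min_max:
  fixes P :: "('m::finite, 'n::finite, 'p) psoco"
  assumes "dcost P \<noteq> 0" "0 \<le> \<delta>" "\<epsilon> \<in> pert_set P x0 y0 s0 \<delta>"
  shows "pert_min P x0 y0 s0 \<delta> \<in> pert_set P x0 y0 s0 \<delta>" "pert_min P x0 y0 s0 \<delta> \<le> \<epsilon>"
    and "pert_max P x0 y0 s0 \<delta> \<in> pert_set P x0 y0 s0 \<delta>" "\<epsilon> \<le> pert_max P x0 y0 s0 \<delta>"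
proof -
  let ?S = "pert_set P x0 y0 s0 \<delta>"
  have S: "compact ?S" "?S \<noteq> {}" using compact_pert_set[OF assms(1,2)] assms(3) by auto
  obtain m where m: "m \<in> ?S" "\<forall>t\<in>?S. m \<le> t" using compact_attains_inf[OF S] by blast
  obtain M where M: "M \<in> ?S" "\<forall>t\<in>?S. t \<le> M" using compact_attains_sup[OF S] by blast
  have "pert_min P x0 y0 s0 \<delta> = m"
    unfolding pert_min_def using m by (intro Least_equality) auto
  with m assms(3) show "pert_min P x0 y0 s0 \<delta> \<in> ?S" "pert_min P x0 y0 s0 \<delta> \<le> \<epsilon>" by auto
  have "pert_max P x0 y0 s0 \<delta> = M"
    unfolding pert_max_def using M by (intro Greatest_equality) auto
  with M assms(3) show "pert_max P x0 y0 s0 \<delta> \<in> ?S" "\<epsilon> \<le> pert_max P x0 y0 s0 \<delta>" by auto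
qed

lemma pert_set_near:
  fixes P :: "('m::finite, 'n::finite, 'p) psoco"
  assumes "dcost P \<noteq> 0" "parameter_of P (x0, y0, s0) = \<epsilon>0" "0 < \<eta>"
  shows "\<forall>\<^sub>F \<delta> in at_right 0. \<forall>\<epsilon>\<in>pert_set P x0 y0 s0 \<delta>. \<bar>\<epsilon> - \<epsilon>0\<bar> < \<eta>"
proof -
  have "isCont (parameter_of P) (x0, y0, s0)"
    using continuous_parameter_of[of UNIV P] by (simp add: continuous_on_eq_continuous_at)
  then obtain d where d: "0 < d" "\<And>z. dist z (x0, y0, s0) < d \<Longrightarrow> dist (parameter_of P z) \<epsilon>0 < \<eta>"
    using assms(2,3) unfolding continuous_at_eps_delta by blast
  have "\<bar>\<epsilon> - \<epsilon>0\<bar> < \<eta>" if \<delta>: "0 < \<delta>" "\<delta> < d" and \<epsilon>: "\<epsilon> \<in> pert_set P x0 y0 s0 \<delta>" for \<delta> \<epsilon>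
  proof -
    obtain z where z: "z \<in> cball (x0, y0, s0) \<delta>" "\<epsilon> = parameter_of P z"
      using \<epsilon> \<delta> pert_set_eq_image[OF assms(1), of \<delta>] by auto
    then have "dist z (x0, y0, s0) < d" using \<delta> by (simp add: mem_cball dist_commute)
    then show ?thesis using d(2) z(2) by (simp add: dist_real_def)
  qed
  then show ?thesis
    using eventually_at_right_real[OF d(1)] by (auto elim!: eventually_mono)
qed

text \<open>
  Close to \<open>c\<close> the set \<open>Collect \<phi>\<close> consists of \<open>c\<close> together with all or none of the points on the left
  and all or none of the points on the right.
\<close>

lemma semialgebraic_interval_near:
  fixes \<phi> :: "real \<Rightarrow> bool"
  assumes "semialgebraic \<phi>" "\<phi> c"
  shows "\<exists>\<eta>>0. \<forall>\<alpha> \<beta>. c - \<eta> < \<alpha> \<longrightarrow> \<beta> < c + \<eta> \<longrightarrow> is_interval ({\<alpha>..\<beta>} \<inter> Collect \<phi>)"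
proof -
  obtain l where l: "\<forall>\<^sub>F t in at_right 0. \<phi> (c - t) = l"
    using semialgebraic_eventually_constant_right[OF assms(1), of c "-1"] by auto
  obtain r where r: "\<forall>\<^sub>F t in at_right 0. \<phi> (c + t) = r"
    using semialgebraic_eventually_constant_right[OF assms(1), of c 1] by auto
  have "\<forall>\<^sub>F t in at_right 0. \<phi> (c - t) = l \<and> \<phi> (c + t) = r"
    using l r by (rule eventually_conj)
  then obtain \<eta> where \<eta>: "\<eta> > 0" "\<And>t. 0 < t \<Longrightarrow> t < \<eta> \<Longrightarrow> \<phi> (c - t) = l \<and> \<phi> (c + t) = r"
    unfolding eventually_at_right_field by auto
  have left: "\<phi> x = l" if "c - \<eta> < x" "x < c" for x using \<eta>(2)[of "c - x"] that by simp
  have right: "\<phi> x = r" if "c < x" "x < c + \<eta>" for x using \<eta>(2)[of "x - c"] that by simp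
  have "is_interval ({\<alpha>..\<beta>} \<inter> Collect \<phi>)" if "c - \<eta> < \<alpha>" "\<beta> < c + \<eta>" for \<alpha> \<beta>
    unfolding is_interval_1
  proof (intro ballI allI impI)
    fix a b x assume ab: "a \<in> {\<alpha>..\<beta>} \<inter> Collect \<phi>" "b \<in> {\<alpha>..\<beta>} \<inter> Collect \<phi>" "a \<le> x \<and> x \<le> b"
    consider "x < c" | "x = c" | "c < x" by linarith
    then have "\<phi> x"
    proof cases
      case 1
      then show ?thesis using left[of x] left[of a] ab that by auto
    next
      case 3
      then show ?thesis using right[of x] right[of b] ab that by auto
    qed (use assms(2) in simp)
    with ab show "x \<in> {\<alpha>..\<beta>} \<inter> Collect \<phi>" by auto
  qed
  with \<eta>(1) show ?thesis by blast
qed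

theorem theorem3:
  fixes P :: "('m::finite, 'n::finite, 'p::finite) psoco"
    and \<epsilon>0 :: real and x0 s0 :: "real^'n" and y0 :: "real^'m"
  assumes blocks: "block_structure P"
    and full_row_rank: "rank (Amat P) = CARD('m)"
    and dcost_nonzero: "dcost P \<noteq> 0"
    and ipc: "interior_point_condition P"
    and eps0: "\<epsilon>0 \<in> interior (val_dom P)"
    and sc: "strictly_complementary P \<epsilon>0 x0 y0 s0"
  shows "\<forall>\<^sub>F \<delta> in at_right (0::real).
    let I = {pert_min P x0 y0 s0 \<delta> .. pert_max P x0 y0 s0 \<delta>} \<inter> same_partition_set P \<epsilon>0
    in (\<exists>\<epsilon>. I = {\<epsilon>}) \<or> (is_interval I \<and> I \<subseteq> same_partition_set P \<epsilon>0 \<and> \<epsilon>0 \<in> I)"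
proof -
  have opt: "x0 \<in> primal_opt P \<epsilon>0" "(y0, s0) \<in> dual_opt P \<epsilon>0"
    using sc by (auto simp: strictly_complementary_def)
  have feas: "Amat P *v x0 = rhs P" "x0 \<in> soc P"
      "transpose (Amat P) *v y0 + s0 = obj P \<epsilon>0" "s0 \<in> soc P"
    using opt by (auto simp: primal_opt_def primal_feas_def dual_opt_def dual_feas_def)
  have jordan: "jordan_prod P x0 s0 = 0"
    using jordan_prod_eq_0[OF blocks feas(2,4) optimal_complementary[OF opt]] .
  have mem: "\<epsilon>0 \<in> pert_set P x0 y0 s0 \<delta>" for \<delta>
    unfolding pert_set_def mem_Collect_eq
    using feas jordan by (intro exI[of _ x0] exI[of _ y0] exI[of _ s0]) simp
  have self: "\<epsilon>0 \<in> same_partition_set P \<epsilon>0"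
    using opt by (auto simp: same_partition_set_def)
  obtain \<eta> where \<eta>: "\<eta> > 0" "\<And>\<alpha> \<beta>. \<epsilon>0 - \<eta> < \<alpha> \<Longrightarrow> \<beta> < \<epsilon>0 + \<eta> \<Longrightarrow>
      is_interval ({\<alpha>..\<beta>} \<inter> same_partition_set P \<epsilon>0)"
    using semialgebraic_interval_near[OF semialgebraic_same_partition self] by auto
  have "\<forall>\<^sub>F \<delta> in at_right 0. \<forall>\<epsilon>\<in>pert_set P x0 y0 s0 \<delta>. \<bar>\<epsilon> - \<epsilon>0\<bar> < \<eta>"
    using pert_set_near[OF dcost_nonzero parameter_of_unique[OF dcost_nonzero feas(3)] \<eta>(1)] .
  then show ?thesis
    using eventually_at_right_less
  proof eventually_elim
    case (elim \<delta>)
    note mm = pert_min_max[OF dcost_nonzero _ mem, of \<delta>]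
    have "is_interval ({pert_min P x0 y0 s0 \<delta> .. pert_max P x0 y0 s0 \<delta>} \<inter> same_partition_set P \<epsilon>0)"
      using elim mm by (intro \<eta>(2)) (force simp: abs_less_iff)+
    moreover have "\<epsilon>0 \<in> {pert_min P x0 y0 s0 \<delta> .. pert_max P x0 y0 s0 \<delta>} \<inter> same_partition_set P \<epsilon>0"
      using elim mm self by simp
    ultimately show ?case unfolding Let_def by blast
  qed
qed

end
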